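(* Let $p\ge 1$, let $P\in\mathcal{P}^{d,D}_{\tau_{\min},L,f_{\min}}$ be the distribution associated to $Q\in\mathcal{Q}^{d,D}_{\tau_{\min},L,f_{\min}}$, and let $M$ be the support of $Q$. Assume that $M$ has a bottleneck $(q_1,q_2)\in M^2$. Let $\mathbb{X}_n=\{X_1,\dots,X_n\}$ where $X_1,\dots,X_n$ are i.i.d. with distribution $Q$. Then $$\mathbb{E}_{P^n}\left[\left|\frac{1}{\tau_M}-\frac{1}{\hat\tau(\mathbb{X}_n)}\right|^p\right]\le C_{\tau_M,f_{\min},d,p}\,n^{-\frac{p}{d}},$$ where $C_{\tau_M,f_{\min},d,p}$ depends only on $\tau_M$, $f_{\min}$, $d$ and $p$, and is a decreasing function of $\tau_M$.
   Context: $D\ge2$; $\mathbb{R}^D$ carries the Euclidean norm; $\mathcal{B}(x,r)$ is the closed ball. $1\le d<D$; $\tau_{\min},L,f_{\min}>0$. Submanifolds are embedded, of class at least $\mathcal{C}^2$. For closed $A\subset\mathbb{R}^D$, $d(z,A)=\inf_{p\in A}\|p-z\|$, $Med(A)=\{z : \exists\, p\ne q\in A,\ \|p-z\|=\|q-z\|=d(z,A)\}$, and the reach is $\tau_A=\inf_{z\in Med(A)}d(z,A)$. $\mathcal{M}^{d,D}_{\tau_{\min},L}$: the set of compact connected $d$-dimensional submanifolds $M\subset\mathbb{R}^D$ without boundary with $\tau_M\ge\tau_{\min}$ and for which every arc-length parametrized geodesic $\gamma_{p,v}$ (starting at $p\in M$ with unit velocity $v\in T_pM$) is $\mathcal{C}^3$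 and satisfies $\|\gamma_{p,v}'''(0)\|\le L$. $\mathcal{Q}^{d,D}_{\tau_{\min},L,f_{\min}}$: the set of probability distributions $Q$ with support some $M\in\mathcal{M}^{d,D}_{\tau_{\min},L}$ and with a density $f$ with respect to the $d$-dimensional Hausdorff measure on $M$ satisfying $\inf_{x\in M}f(x)\ge f_{\min}$. $\mathcal{P}^{d,D}_{\tau_{\min},L,f_{\min}}$: the set of distributions $P$ of $(X,T_XM)$ on $\mathbb{R}^D\times\mathbb{G}^{d,D}$ ($\mathbb{G}^{d,D}$ the Grassmannian of $d$-dimensional linear subspaces of $\mathbb{R}^D$) where $X\sim Q\in\mathcal{Q}^{d,D}_{\tau_{\min},L,f_{\min}}$ and $M$ is the support of $Q$. A bottleneck of $M$ is a pair $(q_1,q_2)\in M^2$ such that there is $z_0\in Med(M)$ with $q_1,q_2\in\mathcal{B}(z_0,\tau_M)$ and $\|q_1-q_2\|=2\tau_M$. For $\mathbb{X}\subset M$, $\hat\tau(\mathbb{X})=\inf_{x\ne y\in\mathbb{X}}\frac{\|y-x\|^2}{2d(y-x,T_xM)}$, with conventions $a/0=+\infty$ for $a>0$, $\inf\emptyset=+\infty$, $1/\infty=0$. *)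

theory Defs
  imports "HOL-Probability.Probability"
begin

section \<open>Euclidean spaces of all dimensions in one type\<close>

text \<open>
  The constant in the theorem must not depend on the ambient dimension \<open>D\<close>, so \<open>D\<close> has to be
  quantified inside the formula and cannot be the cardinality of an index type.  All the spaces
  \<open>\<real>\<^sup>D\<close> are therefore realised inside a single inner product space, the finitely supported real
  sequences, with \<open>\<real>\<^sup>D\<close> being the sequences that vanish from index \<open>D\<close> on.  The inherited norm is
  the Euclidean one.  (The type of finitely supported functions of \<open>HOL-Library\<close> is not used because
  \<open>HOL-Analysis\<close> equips it with the \<open>\<ell>\<^sup>1\<close> norm.)
\<close>

typedef fseq = "{f :: nat \<Rightarrow> real. finite {i. f i \<noteq> 0}}"
  morphisms coord Abs_fseq
  by (rule exI[of _ "\<lambda>_. 0"]) simp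

setup_lifting type_definition_fseq

lemma finite_coord [simp]: "finite {i. coord x i \<noteq> 0}"
  using coord[of x] by simp

lemma fseq_eqI: "(\<And>i. coord x i = coord y i) \<Longrightarrow> x = y"
  by (metis coord_inject ext)

instantiation fseq :: real_vector
begin

lift_definition zero_fseq :: fseq is "\<lambda>_. 0" by simp

lift_definition plus_fseq :: "fseq \<Rightarrow> fseq \<Rightarrow> fseq" is "\<lambda>f g i. f i + g i"
proof -
  fix f g :: "nat \<Rightarrow> real"
  assume "finite {i. f i \<noteq> 0}" "finite {i. g i \<noteq> 0}"
  then have "finite ({i. f i \<noteq> 0} \<union> {i. g i \<noteq> 0})" by simp
  then show "finite {i. f i + g i \<noteq> 0}" by (rule rev_finite_subset) auto
qed

lift_definition minus_fseq :: "fseq \<Rightarrow> fseq \<Rightarrow> fseq" is "\<lambda>f g i. f i - g i"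
proof -
  fix f g :: "nat \<Rightarrow> real"
  assume "finite {i. f i \<noteq> 0}" "finite {i. g i \<noteq> 0}"
  then have "finite ({i. f i \<noteq> 0} \<union> {i. g i \<noteq> 0})" by simp
  then show "finite {i. f i - g i \<noteq> 0}" by (rule rev_finite_subset) auto
qed

lift_definition uminus_fseq :: "fseq \<Rightarrow> fseq" is "\<lambda>f i. - f i" by simp

lift_definition scaleR_fseq :: "real \<Rightarrow> fseq \<Rightarrow> fseq" is "\<lambda>c f i. c * f i"
  by (rule rev_finite_subset) auto

instance
  by standard (transfer; simp add: fun_eq_iff algebra_simps)+

end

lemma coord_simps [simp]:
  "coord 0 i = 0" "coord (x + y) i = coord x i + coord y i"
  "coord (x - y) i = coord x i - coord y i" "coord (- x) i = - coord x i"
  "coord (c *\<^sub>R x) i = c * coord x i"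
  by (transfer; simp)+

instantiation fseq :: real_inner
begin

definition inner_fseq :: "fseq \<Rightarrow> fseq \<Rightarrow> real" where
  "inner_fseq x y = (\<Sum>i | coord x i \<noteq> 0. coord x i * coord y i)"

definition norm_fseq :: "fseq \<Rightarrow> real" where
  "norm_fseq x = sqrt (x \<bullet> x)"

definition dist_fseq :: "fseq \<Rightarrow> fseq \<Rightarrow> real" where
  "dist_fseq x y = norm (x - y)"

definition sgn_fseq :: "fseq \<Rightarrow> fseq" where
  "sgn_fseq x = x /\<^sub>R norm x"

definition uniformity_fseq :: "(fseq \<times> fseq) filter" where
  "uniformity_fseq = (INF e\<in>{0<..}. principal {(x, y). dist x y < e})"

definition open_fseq :: "fseq set \<Rightarrow> bool" where
  "open_fseq U \<longleftrightarrow> (\<forall>x\<in>U. \<forall>\<^sub>F (x', y) in uniformity. x' = x \<longrightarrow> y \<in> U)"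

lemma inner_fseq_superset:
  assumes "finite S" "{i. coord x i \<noteq> 0} \<subseteq> S"
  shows "x \<bullet> y = (\<Sum>i\<in>S. coord x i * coord y i)"
  unfolding inner_fseq_def by (rule sum.mono_neutral_left) (use assms in auto)

instance
proof
  fix x y z :: fseq and r :: real
  let ?S = "{i. coord x i \<noteq> 0} \<union> {i. coord y i \<noteq> 0}"
  have S: "finite ?S" by simp
  have *: "u \<bullet> v = (\<Sum>i\<in>?S. coord u i * coord v i)" if "{i. coord u i \<noteq> 0} \<subseteq> ?S" for u v
    by (rule inner_fseq_superset[OF S that])
  show "x \<bullet> y = y \<bullet> x"
    by (subst (1 2) *) (auto simp: mult.commute)
  show "(x + y) \<bullet> z = x \<bullet> z + y \<bullet> z"
    by (subst (1 2 3) *) (auto simp: algebra_simps sum.distrib)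
  show "(r *\<^sub>R x) \<bullet> y = r * (x \<bullet> y)"
    by (subst (1 2) *) (auto simp: algebra_simps sum_distrib_left)
  show "0 \<le> x \<bullet> x"
    unfolding inner_fseq_def by (rule sum_nonneg) simp
  show "x \<bullet> x = 0 \<longleftrightarrow> x = 0"
  proof
    assume "x \<bullet> x = 0"
    then have "\<forall>i\<in>{i. coord x i \<noteq> 0}. coord x i * coord x i = 0"
      unfolding inner_fseq_def by (subst (asm) sum_nonneg_eq_0_iff) auto
    then show "x = 0" by (intro fseq_eqI) auto
  qed (simp add: inner_fseq_def)
  show "norm x = sqrt (x \<bullet> x)" by (rule norm_fseq_def)
  show "dist x y = norm (x - y)" by (rule dist_fseq_def)
  show "sgn x = x /\<^sub>R norm x" by (rule sgn_fseq_def)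
  show "uniformity = (INF e\<in>{0<..}. principal {(x :: fseq, y). dist x y < e})"
    by (rule uniformity_fseq_def)
  show "open U \<longleftrightarrow> (\<forall>x\<in>U. \<forall>\<^sub>F (x', y) in uniformity. x' = x \<longrightarrow> y \<in> U)" for U :: "fseq set"
    by (rule open_fseq_def)
qed

end

definition Rn :: "nat \<Rightarrow> fseq set" where
  "Rn D = {x. \<forall>i\<ge>D. coord x i = 0}"

lemma norm_Rn:
  assumes "x \<in> Rn D"
  shows "norm x = sqrt (\<Sum>i<D. (coord x i)\<^sup>2)"
proof -
  have "{i. coord x i \<noteq> 0} \<subseteq> {..<D}"
    using assms by (auto simp: Rn_def not_le[symmetric])
  then show ?thesis
    unfolding norm_fseq_def by (subst inner_fseq_superset[of "{..<D}"]) (auto simp: power2_eq_square)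
qed


section \<open>Medial axis, reach, bottlenecks\<close>

definition medial_axis :: "nat \<Rightarrow> fseq set \<Rightarrow> fseq set" where
  "medial_axis D A = {z \<in> Rn D. \<exists>p\<in>A. \<exists>q\<in>A. p \<noteq> q \<and>
      norm (p - z) = infdist z A \<and> norm (q - z) = infdist z A}"

definition reach :: "nat \<Rightarrow> fseq set \<Rightarrow> ereal" where
  "reach D A = (INF z\<in>medial_axis D A. ereal (infdist z A))"

definition bottleneck :: "nat \<Rightarrow> fseq set \<Rightarrow> fseq \<Rightarrow> fseq \<Rightarrow> bool" where
  "bottleneck D M q1 q2 \<longleftrightarrow> q1 \<in> M \<and> q2 \<in> M \<and>
     (\<exists>z0\<in>medial_axis D M. ereal (norm (q1 - z0)) \<le> reach D M \<and> ereal (norm (q2 - z0)) \<le> reach D M) \<and>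
     ereal (norm (q1 - q2)) = 2 * reach D M"


section \<open>Submanifolds and geodesics\<close>

text \<open>
  \<open>Ck_on F k V f\<close>: \<open>f\<close> is of class \<open>C\<^sup>k\<close> on the relatively open subset \<open>V\<close> of the
  finite-dimensional subspace \<open>F\<close>.  Since \<open>V\<close> is open in \<open>F\<close>, the derivative within \<open>V\<close> is
  determined in the directions of \<open>F\<close> and only those are constrained.
\<close>

primrec Ck_on :: "'a::real_normed_vector set \<Rightarrow> nat \<Rightarrow> 'a set \<Rightarrow> ('a \<Rightarrow> 'b::real_normed_vector) \<Rightarrow> bool"
where
  "Ck_on F 0 V f \<longleftrightarrow> continuous_on V f"
| "Ck_on F (Suc k) V f \<longleftrightarrow>
     (\<exists>f'. (\<forall>x\<in>V. (f has_derivative f' x) (at x within V)) \<and> (\<forall>v\<in>F. Ck_on F k V (\<lambda>x. f' x v)))"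

text \<open>Embedded submanifolds without boundary, given by local parametrizations that are
  homeomorphisms onto relatively open subsets of \<open>M\<close> and \<open>C\<^sup>2\<close> immersions.\<close>

definition C2_submanifold :: "nat \<Rightarrow> nat \<Rightarrow> fseq set \<Rightarrow> bool" where
  "C2_submanifold D d M \<longleftrightarrow> M \<subseteq> Rn D \<and>
     (\<forall>p\<in>M. \<exists>U V \<psi> \<phi>. open U \<and> p \<in> U \<and> openin (top_of_set (Rn d)) V \<and>
        homeomorphism V (M \<inter> U) \<psi> \<phi> \<and> Ck_on (Rn d) 2 V \<psi> \<and>
        (\<forall>x\<in>V. \<exists>A. (\<psi> has_derivative A) (at x within V) \<and> (\<forall>v\<in>Rn d. A v = 0 \<longrightarrow> v = 0)))"

definition tangent_space :: "fseq set \<Rightarrow> fseq \<Rightarrow> fseq set" where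
  "tangent_space M p = {v. \<exists>\<gamma> e. 0 < e \<and> \<gamma> C1_differentiable_on {-e<..<e} \<and>
      \<gamma> ` {-e<..<e} \<subseteq> M \<and> \<gamma> 0 = p \<and> (\<gamma> has_vector_derivative v) (at 0)}"

definition vderiv :: "(real \<Rightarrow> fseq) \<Rightarrow> real \<Rightarrow> fseq" where
  "vderiv \<gamma> t = vector_derivative \<gamma> (at t)"

text \<open>For the metric induced by the ambient space, vanishing of the covariant acceleration means
  that the second derivative is normal to \<open>M\<close>.\<close>

definition unit_speed_geodesic :: "fseq set \<Rightarrow> real set \<Rightarrow> (real \<Rightarrow> fseq) \<Rightarrow> bool" where
  "unit_speed_geodesic M I \<gamma> \<longleftrightarrow> open I \<and> is_interval I \<and> \<gamma> ` I \<subseteq> M \<and> Ck_on UNIV 2 I \<gamma> \<and>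
     (\<forall>t\<in>I. norm (vderiv \<gamma> t) = 1) \<and>
     (\<forall>t\<in>I. \<forall>w\<in>tangent_space M (\<gamma> t). vderiv (vderiv \<gamma>) t \<bullet> w = 0)"

definition manifold_class :: "nat \<Rightarrow> nat \<Rightarrow> real \<Rightarrow> real \<Rightarrow> fseq set set" where
  "manifold_class D d \<tau>min L = {M. compact M \<and> connected M \<and> C2_submanifold D d M \<and>
     ereal \<tau>min \<le> reach D M \<and>
     (\<forall>p\<in>M. \<forall>v\<in>tangent_space M p. norm v = 1 \<longrightarrow>
        (\<forall>I \<gamma>. unit_speed_geodesic M I \<gamma> \<and> 0 \<in> I \<and> \<gamma> 0 = p \<and> vderiv \<gamma> 0 = v \<longrightarrow>
           Ck_on UNIV 3 I \<gamma> \<and> norm ((vderiv ^^ 3) \<gamma> 0) \<le> L))}"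


section \<open>Hausdorff measure and the statistical models\<close>

text \<open>The normalisation is the one for which the \<open>d\<close>-dimensional Hausdorff measure agrees with the
  \<open>d\<close>-dimensional volume.  Boundedness of the covering sets is required explicitly because
  \<open>diameter\<close> is meaningless for unbounded sets.\<close>

definition hausdorff_pre :: "nat \<Rightarrow> real \<Rightarrow> 'a::metric_space set \<Rightarrow> ennreal" where
  "hausdorff_pre d \<delta> A = (INF U\<in>{U :: nat \<Rightarrow> 'a set.
      A \<subseteq> (\<Union>i. U i) \<and> (\<forall>i. bounded (U i) \<and> diameter (U i) \<le> \<delta>)}.
      \<Sum>i. ennreal (unit_ball_vol (real d) * (diameter (U i) / 2) ^ d))"

text \<open>The supremum below is a metric outer measure, hence countably additive on Borel sets by
  Caratheodory's criterion.\<close>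

definition hausdorff_measure :: "nat \<Rightarrow> 'a::metric_space measure" where
  "hausdorff_measure d = measure_of UNIV (sets borel) (\<lambda>A. SUP \<delta>\<in>{0<..}. hausdorff_pre d \<delta> A)"

definition measure_support :: "'a::topological_space measure \<Rightarrow> 'a set" where
  "measure_support Q =
     {x \<in> space Q. \<forall>U. open U \<and> x \<in> U \<longrightarrow> 0 < emeasure Q (U \<inter> space Q)}"

text \<open>Distributions on \<open>\<real>\<^sup>D\<close> are measures on the Borel space of \<open>Rn D\<close>.\<close>

definition Q_class :: "nat \<Rightarrow> nat \<Rightarrow> real \<Rightarrow> real \<Rightarrow> real \<Rightarrow> fseq measure set" where
  "Q_class D d \<tau>min L fmin = {Q. prob_space Q \<and> sets Q = sets (restrict_space borel (Rn D)) \<and>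
     (\<exists>M\<in>manifold_class D d \<tau>min L. measure_support Q = M \<and>
        (\<exists>f :: fseq \<Rightarrow> real. f \<in> borel_measurable (restrict_space borel M) \<and> (\<forall>x\<in>M. fmin \<le> f x) \<and>
           Q = density (restrict_space (hausdorff_measure d) (Rn D))
                 (\<lambda>x. ennreal (f x) * indicator M x)))}"

definition grassmannian :: "nat \<Rightarrow> nat \<Rightarrow> fseq set set" where
  "grassmannian D d = {T. subspace T \<and> T \<subseteq> Rn D \<and> dim T = d}"

text \<open>The gap of two subspaces; for equal dimensions it is the operator norm of the difference of
  the orthogonal projections.\<close>

definition gap :: "fseq set \<Rightarrow> fseq set \<Rightarrow> real" where
  "gap S T = max (SUP v\<in>S \<inter> cball 0 1. infdist v T) (SUP v\<in>T \<inter> cball 0 1. infdist v S)"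

definition grassmannian_borel :: "nat \<Rightarrow> nat \<Rightarrow> fseq set measure" where
  "grassmannian_borel D d = sigma (grassmannian D d)
     {W. W \<subseteq> grassmannian D d \<and> (\<forall>S\<in>W. \<exists>r>0. \<forall>T\<in>grassmannian D d. gap S T < r \<longrightarrow> T \<in> W)}"

text \<open>The distribution of \<open>(X, T\<^sub>X M)\<close> for \<open>X\<close> with distribution \<open>Q\<close> and \<open>M\<close> the support of \<open>Q\<close>.
  \<open>Q\<close> is first restricted to its support, the only place where the tangent space makes sense.\<close>

definition tangent_law :: "nat \<Rightarrow> nat \<Rightarrow> fseq measure \<Rightarrow> (fseq \<times> fseq set) measure" where
  "tangent_law D d Q = distr (restrict_space Q (measure_support Q))
     (restrict_space borel (Rn D) \<Otimes>\<^sub>M grassmannian_borel D d)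
     (\<lambda>x. (x, tangent_space (measure_support Q) x))"

definition P_class :: "nat \<Rightarrow> nat \<Rightarrow> real \<Rightarrow> real \<Rightarrow> real \<Rightarrow> (fseq \<times> fseq set) measure set" where
  "P_class D d \<tau>min L fmin = tangent_law D d ` Q_class D d \<tau>min L fmin"


section \<open>The estimator and the loss\<close>

text \<open>The stated conventions (\<open>a / 0 = \<infinity>\<close> for \<open>a > 0\<close>, \<open>1 / \<infinity> = 0\<close>, infimum of the empty set
  is \<open>\<infinity>\<close>) are those of \<open>ereal\<close>.\<close>

definition tau_hat :: "fseq set \<Rightarrow> fseq set \<Rightarrow> ereal" where
  "tau_hat M X = (INF (x, y)\<in>{(x, y). x \<in> X \<and> y \<in> X \<and> x \<noteq> y}.
     ereal ((norm (y - x))\<^sup>2) / ereal (2 * infdist (y - x) (tangent_space M x)))"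

definition abs_powr :: "ereal \<Rightarrow> real \<Rightarrow> ennreal" where
  "abs_powr x p = (if \<bar>x\<bar> = \<infinity> then \<infinity> else ennreal (\<bar>real_of_ereal x\<bar> powr p))"

end

theory Submission
  imports Defs "HOL-Homology.Brouwer_Degree" "HOL-Real_Asymp.Real_Asymp"
begin

text \<open>
  Write \<open>\<tau>\<close> for the reach of \<open>M\<close>. The estimator never falls below \<open>\<tau>\<close>: by Federer's inequality
  (\<open>inner_normal_le\<close>) the open balls of radius \<open>\<tau>\<close> tangent to \<open>M\<close> contain no point of \<open>M\<close>, which says
  \<open>2 \<tau> d(y - x, T\<^sub>x M) \<le> |y - x|\<^sup>2\<close>. At the bottleneck, \<open>q2 - q1\<close> is normal to \<open>M\<close> at \<open>q1\<close> and has length \<open>2 \<tau>\<close>,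
  so the pair \<open>(q1, q2)\<close> attains the value \<open>\<tau>\<close>. A pair of sample points within distance \<open>r\<close> of
  \<open>q1\<close> and \<open>q2\<close> therefore gives an error \<open>O(r / \<tau>\<^sup>2)\<close> for the inverse reach (\<open>bottleneck_ratio\<close>). Balls of
  radius \<open>r\<close> have \<open>Q\<close>-mass at least \<open>c r\<^sup>d\<close> (\<open>density_ball_ge\<close>), so among \<open>n\<close> independent points the
  nearest ones to \<open>q1\<close> and \<open>q2\<close> are at distance of order \<open>n\<^sup>-\<^sup>1\<^sup>/\<^sup>d\<close>, with exponential tails, and the \<open>p\<close>-th
  moment is of order \<open>n\<^sup>-\<^sup>p\<^sup>/\<^sup>d\<close> (\<open>bottleneck_risk\<close>).

  All geometric constants have to depend on \<open>\<tau>\<close> and \<open>d\<close> only. Three facts carry the geometry, and each is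
  global, that is, it holds up to distances comparable to \<open>\<tau>\<close>:

  \<^item> Federer's inequality. Near \<open>x\<close> it follows, with a worse constant, from \<open>C\<^sup>2\<close> charts
    (\<open>C2_tangent_frame\<close>). A tangent ball disjoint from \<open>M\<close> can then be enlarged up to radius \<open>\<tau>\<close>, by
    Brouwer's theorem (\<open>normal_ray_extend\<close>).

  \<^item> The point \<open>q + t v\<close> is within \<open>2 t\<^sup>2 / \<tau>\<close> of \<open>M\<close> for unit tangent vectors \<open>v\<close> and \<open>t < \<tau>\<close>
    (\<open>tangent_ray_near\<close>). This is a differential inequality for the distance to \<open>M\<close> along the ray, in
    which Federer's inequality is used for the normal pointing away from the ray. It takes the place of
    geodesics: it controls the tangent spaces near the bottleneck, and it is what makes the
    next fact possible.

  \<^item> The projection of \<open>M\<close> near \<open>q\<close> to the tangent space at \<open>q\<close> covers a ball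
    (\<open>tangent_projection_covers\<close>), again by Brouwer's theorem. Since projections do not increase
    distances, this bounds the Hausdorff measure from below.

  Brouwer's theorem is used in the form \<open>near_identity_covers\<close>: a continuous map of a ball that moves
  points by at most \<open>\<epsilon>\<close> covers the open concentric ball whose radius is smaller by \<open>\<epsilon>\<close>.
\<close>

section \<open>Coordinates on the finite-dimensional spaces\<close>

lemma inner_Rn: "x \<in> Rn D \<Longrightarrow> x \<bullet> y = (\<Sum>i<D. coord x i * coord y i)"
  by (rule inner_fseq_superset) (auto simp: Rn_def not_le[symmetric])

lemma abs_coord_le_norm: "\<bar>coord x i\<bar> \<le> norm x"
proof (cases "coord x i = 0")
  case False
  have "coord x i * coord x i \<le> (\<Sum>i | coord x i \<noteq> 0. coord x i * coord x i)"
    by (rule member_le_sum) (use False in auto)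
  then have "(coord x i)\<^sup>2 \<le> (norm x)\<^sup>2"
    unfolding power2_norm_eq_inner inner_fseq_def by (simp add: power2_eq_square)
  then show ?thesis
    by (metis abs_le_square_iff abs_norm_cancel)
qed simp

lemma bounded_linear_coord: "bounded_linear (\<lambda>x. coord x i)"
  by (rule bounded_linear_intro[of _ 1]) (auto simp: abs_coord_le_norm)

lemma continuous_on_coord [continuous_intros]:
  "continuous_on S f \<Longrightarrow> continuous_on S (\<lambda>x. coord (f x) i)"
  using bounded_linear.continuous_on[OF bounded_linear_coord] .

lemma subspace_Rn: "subspace (Rn D)"
  by (auto simp: subspace_def Rn_def)

lemma closed_Rn: "closed (Rn D)"
proof -
  have "Rn D = (\<Inter>i\<in>{D..}. {x. coord x i = 0})"
    by (auto simp: Rn_def)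
  moreover have "closed {x. coord x i = 0}" for i
    by (intro closed_Collect_eq continuous_intros)
  ultimately show ?thesis
    by (auto intro!: closed_INT)
qed

definition unit_fseq :: "nat \<Rightarrow> fseq" where
  "unit_fseq i = Abs_fseq (\<lambda>j. if j = i then 1 else 0)"

lemma coord_unit_fseq: "coord (unit_fseq i) j = (if j = i then 1 else 0)"
  by (simp add: unit_fseq_def Abs_fseq_inverse)

lemma coord_sum: "coord (sum f A) i = (\<Sum>a\<in>A. coord (f a) i)"
  by (induction A rule: infinite_finite_induct) auto

definition vec_of :: "nat \<Rightarrow> (nat \<Rightarrow> real) \<Rightarrow> fseq" where
  "vec_of D f = (\<Sum>i<D. f i *\<^sub>R unit_fseq i)"

lemma coord_vec_of: "coord (vec_of D f) i = (if i < D then f i else 0)"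
proof -
  have "coord (vec_of D f) i = (\<Sum>j<D. if i = j then f j else 0)"
    unfolding vec_of_def coord_sum by (intro sum.cong) (auto simp: coord_unit_fseq)
  also have "\<dots> = (if i < D then f i else 0)"
    by simp
  finally show ?thesis .
qed

lemma vec_of_in_Rn [simp]: "vec_of D f \<in> Rn D"
  by (simp add: Rn_def coord_vec_of)

lemma vec_of_coord: "x \<in> Rn D \<Longrightarrow> vec_of D (coord x) = x"
  by (rule fseq_eqI) (auto simp: coord_vec_of Rn_def)

section \<open>Maps close to the identity\<close>

text \<open>
The spheres of singular homology live in spaces of functions on the naturals, so their dimension is a
number and not a type; this makes topological facts available for all \<open>D\<close> at once.
\<close>

lemma homeomorphic_sphere_nsphere:
  "top_of_set (Rn (Suc n) \<inter> sphere 0 1) homeomorphic_space nsphere n"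
proof -
  have 1: "continuous_map (top_of_set (Rn (Suc n) \<inter> sphere 0 1)) (nsphere n) coord"
  proof -
    have "(\<Sum>i\<le>n. (coord x i)\<^sup>2) = 1" if "x \<in> Rn (Suc n)" "norm x = 1" for x
      using norm_Rn[OF that(1)] that(2) by (simp add: lessThan_Suc_atMost)
    moreover have "continuous_map (top_of_set S) (powertop_real UNIV) coord" for S
      by (auto simp: continuous_map_componentwise_UNIV intro!: continuous_intros)
    ultimately show ?thesis
      by (auto simp: nsphere continuous_map_in_subtopology Rn_def)
  qed
  have 2: "continuous_map (nsphere n) (top_of_set (Rn (Suc n) \<inter> sphere 0 1)) (vec_of (Suc n))"
  proof -
    have "continuous_map (nsphere n) euclidean (\<lambda>f. f i *\<^sub>R unit_fseq i)" for i
    proof -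
      have "continuous_map (nsphere n) euclideanreal (\<lambda>f. f i)"
        by (simp add: nsphere continuous_map_from_subtopology
            continuous_map_product_projection[of i UNIV "\<lambda>_. euclideanreal"])
      then show ?thesis
        using continuous_map_compose[of "nsphere n" euclideanreal "\<lambda>f. f i" euclidean "\<lambda>c. c *\<^sub>R unit_fseq i"]
        by (simp add: o_def continuous_on_scaleR)
    qed
    then have "continuous_map (nsphere n) euclidean (vec_of (Suc n))"
      unfolding vec_of_def by (intro continuous_map_sum) auto
    moreover have "norm (vec_of (Suc n) f) = 1" if "(\<Sum>i\<le>n. (f i)\<^sup>2) = 1" for f
      using that by (subst norm_Rn[of _ "Suc n"]) (auto simp: coord_vec_of lessThan_Suc_atMost)
    ultimately show ?thesis
      by (auto simp: continuous_map_in_subtopology nsphere)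
  qed
  show ?thesis
    unfolding homeomorphic_space_def homeomorphic_maps_def
  proof (intro exI[of _ coord] exI[of _ "vec_of (Suc n)"] conjI ballI)
    show "vec_of (Suc n) (coord x) = x" if "x \<in> topspace (top_of_set (Rn (Suc n) \<inter> sphere 0 1))" for x
      using that by (simp add: vec_of_coord)
    show "coord (vec_of (Suc n) y) = y" if "y \<in> topspace (nsphere n)" for y
      using that by (auto simp: coord_vec_of nsphere fun_eq_iff)
  qed (fact 1 2)+
qed

lemma not_contractible_sphere_Rn:
  assumes "0 < D"
  shows "\<not> contractible (Rn D \<inter> sphere 0 1)"
proof -
  obtain n where "D = Suc n" using assms by (cases D) auto
  then show ?thesis
    using homeomorphic_space_contractibility[OF homeomorphic_sphere_nsphere[of n]]
      non_contractible_space_nsphere[of n] by simp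
qed

text \<open>
A form of Brouwer's fixed point theorem. If \<open>w\<close> were missed, normalising \<open>f - w\<close> would contract the
sphere: on the boundary it is homotopic to the identity, and the ball fills it in.
\<close>

theorem near_identity_covers:
  assumes D: "0 < D" and r0: "0 < r" and cont: "continuous_on (Rn D \<inter> cball 0 r) f"
    and im: "f ` (Rn D \<inter> cball 0 r) \<subseteq> Rn D"
    and near: "\<And>u. u \<in> Rn D \<Longrightarrow> norm u \<le> r \<Longrightarrow> norm (f u - u) \<le> \<epsilon>"
    and w: "w \<in> Rn D" "norm w + \<epsilon> < r"
  shows "w \<in> f ` (Rn D \<inter> cball 0 r)"
proof (rule ccontr)
  assume miss: "w \<notin> f ` (Rn D \<inter> cball 0 r)"
  let ?S = "Rn D \<inter> sphere 0 (1::real)"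
  let ?P = "Rn D - {0}"
  let ?g = "\<lambda>u. f (r *\<^sub>R u) - w"
  have scal: "c *\<^sub>R u \<in> Rn D" if "u \<in> Rn D" for c u
    using that subspace_Rn by (simp add: subspace_scale)
  have dif: "u - v \<in> Rn D" if "u \<in> Rn D" "v \<in> Rn D" for u v
    using that subspace_Rn by (simp add: subspace_diff)
  have ball: "(r * t) *\<^sub>R u \<in> Rn D \<inter> cball 0 r" if "u \<in> ?S" "0 \<le> t" "t \<le> 1" for t u
    using that r0 scal by (auto simp: abs_mult mult_left_le)
  have ball1: "r *\<^sub>R u \<in> Rn D \<inter> cball 0 r" if "u \<in> ?S" for u
    using ball[OF that, of 1] by simp
  have contg: "continuous_on ?S ?g"
    by (intro continuous_intros continuous_on_compose2[OF cont]) (use ball1 in auto)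
  \<comment> \<open>The segment from \<open>r u\<close> to \<open>f (r u) - w\<close> avoids \<open>0\<close> because its points differ from \<open>r u\<close> by
    less than \<open>r\<close>.\<close>
  have h1: "homotopic_with_canon (\<lambda>z. True) ?S ?P (\<lambda>u. r *\<^sub>R u) ?g"
  proof (rule homotopic_with_linear)
    show "continuous_on ?S ?g" by (rule contg)
    fix u assume u: "u \<in> ?S"
    show "closed_segment (r *\<^sub>R u) (?g u) \<subseteq> ?P"
    proof
      fix y assume "y \<in> closed_segment (r *\<^sub>R u) (?g u)"
      then obtain s where s: "0 \<le> s" "s \<le> 1" "y = (1 - s) *\<^sub>R (r *\<^sub>R u) + s *\<^sub>R ?g u"
        by (auto simp: in_segment)
      have fu: "f (r *\<^sub>R u) \<in> Rn D" using im ball1[OF u] by blast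
      have "y = r *\<^sub>R u + s *\<^sub>R ((f (r *\<^sub>R u) - r *\<^sub>R u) - w)"
        unfolding s(3) by (simp add: algebra_simps)
      moreover have "norm (s *\<^sub>R ((f (r *\<^sub>R u) - r *\<^sub>R u) - w)) < r"
      proof -
        have "norm ((f (r *\<^sub>R u) - r *\<^sub>R u) - w) \<le> norm (f (r *\<^sub>R u) - r *\<^sub>R u) + norm w"
          by (rule norm_triangle_ineq4)
        also have "\<dots> < r" using near[of "r *\<^sub>R u"] ball1[OF u] w by auto
        finally show ?thesis using s by (simp add: order_le_less_trans[OF mult_left_le_one_le])
      qed
      moreover have "norm (r *\<^sub>R u) = r" using u r0 by simp
      ultimately have "y \<noteq> 0"
        by (metis add_eq_0_iff norm_minus_cancel less_irrefl)
      moreover have "y \<in> Rn D"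
        unfolding s(3) using u fu w by (intro subspace_add[OF subspace_Rn] scal dif) auto
      ultimately show "y \<in> ?P" by simp
    qed
  qed (intro continuous_intros)
  \<comment> \<open>Shrinking the sphere to the centre is possible in the complement of \<open>0\<close> because \<open>f\<close> misses
    \<open>w\<close>.\<close>
  have h2: "homotopic_with_canon (\<lambda>z. True) ?S ?P ?g (\<lambda>u. f 0 - w)"
    unfolding homotopic_with_def
  proof (rule exI[of _ "\<lambda>z. f ((r * (1 - fst z)) *\<^sub>R snd z) - w"], intro conjI ballI allI)
    have "continuous_on ({0..1} \<times> ?S) (\<lambda>z. f ((r * (1 - fst z)) *\<^sub>R snd z) - w)"
    proof (intro continuous_intros continuous_on_compose2[OF cont])
      show "(\<lambda>z. (r * (1 - fst z)) *\<^sub>R snd z) ` ({0..1} \<times> ?S) \<subseteq> Rn D \<inter> cball 0 r"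
        using ball by fastforce
    qed
    moreover have "f ((r * (1 - t)) *\<^sub>R u) - w \<in> ?P" if "t \<in> {0..1}" "u \<in> ?S" for t u
    proof -
      have "(r * (1 - t)) *\<^sub>R u \<in> Rn D \<inter> cball 0 r" using ball[of u "1 - t"] that by simp
      then have "f ((r * (1 - t)) *\<^sub>R u) \<in> f ` (Rn D \<inter> cball 0 r)" by (rule imageI)
      then have "f ((r * (1 - t)) *\<^sub>R u) \<in> Rn D" "f ((r * (1 - t)) *\<^sub>R u) \<noteq> w"
        using im miss by auto
      then show ?thesis using dif[OF _ w(1)] by simp
    qed
    ultimately show "continuous_map (prod_topology (top_of_set {0..1}) (top_of_set ?S)) (top_of_set ?P)
        (\<lambda>z. f ((r * (1 - fst z)) *\<^sub>R snd z) - w)"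
      by (simp add: image_subset_iff Pi_iff)
  qed auto
  have h3: "homotopic_with_canon (\<lambda>z. True) ?S ?P (\<lambda>u. r *\<^sub>R u) (\<lambda>u. f 0 - w)"
    using homotopic_with_trans[OF h1 h2] .
  have "homotopic_with_canon (\<lambda>z. True) ?S ?S (sgn \<circ> (\<lambda>u. r *\<^sub>R u)) (sgn \<circ> (\<lambda>u. f 0 - w))"
  proof (rule homotopic_with_compose_continuous_left[OF h3])
    show "continuous_on ?P sgn" by (intro continuous_intros) auto
    show "sgn \<in> ?P \<rightarrow> ?S" by (auto simp: norm_sgn sgn_div_norm scal)
  qed
  then have "homotopic_with_canon (\<lambda>z. True) ?S ?S id (\<lambda>u. sgn (f 0 - w))"
    by (rule homotopic_with_eq) (use r0 in \<open>auto simp: sgn_scaleR sgn_div_norm\<close>)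
  then have "contractible ?S" by (auto simp: contractible_def)
  then show False using not_contractible_sphere_Rn[OF D] by simp
qed

lemma near_identity_covers_center:
  assumes D: "0 < D" and r0: "0 < r" and c: "c \<in> Rn D"
    and cont: "continuous_on (Rn D \<inter> cball c r) f"
    and im: "f ` (Rn D \<inter> cball c r) \<subseteq> Rn D"
    and near: "\<And>z. z \<in> Rn D \<Longrightarrow> dist c z \<le> r \<Longrightarrow> norm (f z - z) \<le> \<epsilon>" and "\<epsilon> < r"
  obtains z where "z \<in> Rn D" "dist c z \<le> r" "f z = c"
proof -
  have add: "u \<in> Rn D \<Longrightarrow> c + u \<in> Rn D" for u
    using c by (rule subspace_add[OF subspace_Rn])
  have "0 \<in> (\<lambda>u. f (c + u) - c) ` (Rn D \<inter> cball 0 r)"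
  proof (rule near_identity_covers[where \<epsilon> = \<epsilon>])
    show "continuous_on (Rn D \<inter> cball 0 r) (\<lambda>u. f (c + u) - c)"
      by (intro continuous_intros continuous_on_compose2[OF cont])
        (use add in \<open>auto simp: dist_norm\<close>)
    show "(\<lambda>u. f (c + u) - c) ` (Rn D \<inter> cball 0 r) \<subseteq> Rn D"
    proof clarify
      fix u assume "u \<in> Rn D" "u \<in> cball 0 r"
      then have "c + u \<in> Rn D \<inter> cball c r" using add by (auto simp: dist_norm)
      then show "f (c + u) - c \<in> Rn D" using im c by (intro subspace_diff[OF subspace_Rn]) auto
    qed
    show "norm (f (c + u) - c - u) \<le> \<epsilon>" if "u \<in> Rn D" "norm u \<le> r" for u
      using near[of "c + u"] add that by (simp add: dist_norm algebra_simps)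
  qed (use assms in \<open>auto simp: subspace_0[OF subspace_Rn]\<close>)
  then obtain u where "u \<in> Rn D" "norm u \<le> r" "f (c + u) = c" by auto
  then show thesis using that[of "c + u"] add by (auto simp: dist_norm)
qed

section \<open>Tangent vectors and the distance function\<close>

text \<open>
Comparison of functions that need not be differentiable: if \<open>f b > 0\<close>, the last time at which
\<open>f \<le> 0\<close> is a zero of \<open>f\<close>, but \<open>f\<close> does not become positive immediately after a zero.
\<close>

lemma nonpos_if_no_upcrossing:
  fixes f :: "real \<Rightarrow> real"
  assumes "a \<le> b" and cont: "continuous_on {a..b} f" and "f a \<le> 0"
    and step: "\<And>t. a \<le> t \<Longrightarrow> t < b \<Longrightarrow> f t = 0 \<Longrightarrow> \<exists>\<delta>>0. \<forall>h. 0 < h \<and> h < \<delta> \<longrightarrow> f (t + h) \<le> 0"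
  shows "f b \<le> 0"
proof (rule ccontr)
  assume fb: "\<not> f b \<le> 0"
  let ?S = "{t \<in> {a..b}. f t \<le> 0}"
  have "closed ?S"
    by (intro continuous_on_closed_Collect_le cont continuous_intros)
  then have "compact ?S"
    by (auto simp: compact_eq_bounded_closed intro: bounded_subset[of "{a..b}"])
  moreover have "a \<in> ?S" using assms by auto
  ultimately obtain t0 where t0: "t0 \<in> ?S" and max: "\<And>t. t \<in> ?S \<Longrightarrow> t \<le> t0"
    using compact_attains_sup[of ?S] by auto
  have "t0 < b" using t0 fb by (cases "t0 = b") auto
  obtain t where t: "t0 \<le> t" "t \<le> b" "f t = 0"
    using IVT'[of f t0 0 b] t0 fb continuous_on_subset[OF cont, of "{t0..b}"] by auto
  then have "t = t0" using max[of t] t0 by auto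
  with t step[of t0] t0 \<open>t0 < b\<close> obtain \<delta> where d: "\<delta> > 0" "\<And>h. 0 < h \<Longrightarrow> h < \<delta> \<Longrightarrow> f (t0 + h) \<le> 0"
    by auto
  let ?h = "min (\<delta> / 2) (b - t0)"
  have "0 < ?h" "?h < \<delta>" using d \<open>t0 < b\<close> by auto
  then have "f (t0 + ?h) \<le> 0" by (rule d)
  then have "t0 + ?h \<in> ?S" using t0 \<open>0 < ?h\<close> by auto
  then show False using max \<open>0 < ?h\<close> by fastforce
qed

lemma tangent_space_subset_Rn:
  assumes "M \<subseteq> Rn D" "v \<in> tangent_space M x"
  shows "v \<in> Rn D"
proof -
  obtain \<gamma> e where g: "0 < e" "\<gamma> ` {-e<..<e} \<subseteq> M" "\<gamma> 0 = x" "(\<gamma> has_vector_derivative v) (at 0)"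
    using assms(2) by (auto simp: tangent_space_def)
  have "coord v i = 0" if "i \<ge> D" for i
  proof -
    have "((\<lambda>t. coord (\<gamma> t) i) has_vector_derivative coord v i) (at 0)"
      by (rule bounded_linear.has_vector_derivative[OF bounded_linear_coord g(4)])
    moreover have "((\<lambda>t. coord (\<gamma> t) i) has_vector_derivative 0) (at 0)"
    proof (rule has_vector_derivative_transform_within_open[of "\<lambda>t. 0" 0 0 "{-e<..<e}"])
      show "0 = coord (\<gamma> t) i" if "t \<in> {-e<..<e}" for t
      proof -
        have "\<gamma> t \<in> Rn D" using g(2) that assms(1) by blast
        then show ?thesis using \<open>i \<ge> D\<close> by (simp add: Rn_def)
      qed
    qed (use g in auto)
    ultimately show ?thesis using vector_derivative_unique_at by blast
  qed
  then show ?thesis by (simp add: Rn_def)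
qed

text \<open>
The distance to \<open>M\<close> is \<open>o(t)\<close> along a tangent ray, because the curve representing \<open>v\<close> is that close to
the ray. This is the initial condition for the growth estimate of the distance.
\<close>

lemma infdist_tangent_small:
  assumes "v \<in> tangent_space M x" "0 < \<epsilon>"
  obtains s where "0 < s" "\<And>t. 0 < t \<Longrightarrow> t < s \<Longrightarrow> infdist (x + t *\<^sub>R v) M \<le> \<epsilon> * t"
proof -
  obtain \<gamma> e where g: "0 < e" "\<gamma> ` {-e<..<e} \<subseteq> M" "\<gamma> 0 = x" "(\<gamma> has_vector_derivative v) (at 0)"
    using assms(1) by (auto simp: tangent_space_def)
  obtain d where d: "d > 0" "\<And>t. norm t < d \<Longrightarrow> norm (\<gamma> t - \<gamma> 0 - t *\<^sub>R v) \<le> \<epsilon> * norm t"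
    using g(4) assms(2) unfolding has_vector_derivative_def has_derivative_at_alt
    by (metis diff_zero)
  show thesis
  proof (rule that[of "min d e"])
    show "infdist (x + t *\<^sub>R v) M \<le> \<epsilon> * t" if "0 < t" "t < min d e" for t
    proof -
      have "\<gamma> t \<in> M" using g that by (auto simp: image_subset_iff)
      then have "infdist (x + t *\<^sub>R v) M \<le> dist (x + t *\<^sub>R v) (\<gamma> t)" by (rule infdist_le)
      also have "\<dots> = norm (\<gamma> t - \<gamma> 0 - t *\<^sub>R v)"
        using g(3) by (simp add: dist_norm norm_minus_commute algebra_simps)
      also have "\<dots> \<le> \<epsilon> * t" using d(2)[of t] that by simp
      finally show ?thesis .
    qed
  qed (use d g in auto)
qed

lemma nearest_point_orthogonal:
  assumes "v \<in> tangent_space M x" and near: "\<And>y. y \<in> M \<Longrightarrow> norm (z - x) \<le> norm (z - y)"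
  shows "(z - x) \<bullet> v = 0"
proof -
  obtain \<gamma> e where g: "0 < e" "\<gamma> ` {-e<..<e} \<subseteq> M" "\<gamma> 0 = x" "(\<gamma> has_vector_derivative v) (at 0)"
    using assms(1) by (auto simp: tangent_space_def)
  have "((\<lambda>t. (z - \<gamma> t) \<bullet> (z - \<gamma> t)) has_derivative
      (\<lambda>h. (z - \<gamma> 0) \<bullet> (0 - h *\<^sub>R v) + (0 - h *\<^sub>R v) \<bullet> (z - \<gamma> 0))) (at 0)"
    using g(4) unfolding has_vector_derivative_def
    by (intro derivative_intros) auto
  then have "((\<lambda>t. (z - \<gamma> t) \<bullet> (z - \<gamma> t)) has_real_derivative (- 2 * ((z - x) \<bullet> v))) (at 0)"
    unfolding has_field_derivative_def
    by (rule has_derivative_eq_rhs) (auto simp: fun_eq_iff g(3) inner_commute algebra_simps)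
  moreover have "\<forall>t. \<bar>0 - t\<bar> < e \<longrightarrow> (z - \<gamma> 0) \<bullet> (z - \<gamma> 0) \<le> (z - \<gamma> t) \<bullet> (z - \<gamma> t)"
  proof (intro allI impI)
    fix t assume "\<bar>0 - t\<bar> < e"
    then have "t \<in> {-e<..<e}" by auto
    then have "\<gamma> t \<in> M" using g(2) by blast
    then show "(z - \<gamma> 0) \<bullet> (z - \<gamma> 0) \<le> (z - \<gamma> t) \<bullet> (z - \<gamma> t)"
      using near[of "\<gamma> t"] g(3) by (simp add: power2_norm_eq_inner[symmetric])
  qed
  ultimately have "- 2 * ((z - x) \<bullet> v) = 0"
    using DERIV_local_min[of _ _ 0 e] g(1) by blast
  then show ?thesis by simp
qed

section \<open>Nearest points and Federer's inequality\<close>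

text \<open>
Everything about the reach is derived from a lower bound \<open>\<tau>\<close> on the distance from \<open>M\<close> to its medial
axis. Below that distance nearest points are unique, hence continuous.
\<close>

locale reach_bound =
  fixes D :: nat and M :: "fseq set" and \<tau> :: real
  assumes D_pos: "0 < D" and compact_M: "compact M" and M_nonempty: "M \<noteq> {}" and M_Rn: "M \<subseteq> Rn D"
    and tau_pos: "0 < \<tau>"
    and medial_far: "\<And>z. z \<in> medial_axis D M \<Longrightarrow> \<tau> \<le> infdist z M"
begin

definition foot :: "fseq \<Rightarrow> fseq" where
  "foot z = (SOME x. x \<in> M \<and> dist z x = infdist z M)"

lemma foot: "foot z \<in> M" "dist z (foot z) = infdist z M"
proof -
  obtain x where x: "x \<in> M" "\<And>y. y \<in> M \<Longrightarrow> dist z x \<le> dist z y"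
    using continuous_attains_inf[OF compact_M M_nonempty, of "dist z"]
      continuous_on_dist[OF continuous_on_const continuous_on_id] by blast
  have "infdist z M = dist z x"
    unfolding infdist_def using M_nonempty x
    by (auto intro!: cINF_lower2 cINF_greatest antisym bdd_belowI[of _ 0])
  then have "\<exists>x. x \<in> M \<and> dist z x = infdist z M" using x by auto
  from someI_ex[OF this] show "foot z \<in> M" "dist z (foot z) = infdist z M"
    by (auto simp: foot_def)
qed

lemma foot_eqI:
  assumes "z \<in> Rn D" "infdist z M < \<tau>" "x \<in> M" "dist z x \<le> infdist z M"
  shows "foot z = x"
proof (rule ccontr)
  assume "foot z \<noteq> x"
  moreover have "norm (x - z) = infdist z M" "norm (foot z - z) = infdist z M"
    using foot[of z] assms infdist_le[OF assms(3), of z] by (auto simp: dist_norm norm_minus_commute)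
  ultimately have "z \<in> medial_axis D M"
    unfolding medial_axis_def using assms foot(1)[of z] by blast
  then show False using medial_far assms by fastforce
qed

text \<open>
Outside a neighbourhood of \<open>foot z\<close>, the compact set \<open>M\<close> has a distance from \<open>z\<close> that exceeds the
minimal one by a positive gap; nearest points of \<open>z'\<close> close to \<open>z\<close> cannot lie there.
\<close>

lemma continuous_on_foot: "continuous_on {z \<in> Rn D. infdist z M < \<tau>} foot"
  unfolding continuous_on_iff
proof (intro ballI allI impI)
  fix z and e :: real assume z: "z \<in> {z \<in> Rn D. infdist z M < \<tau>}" and e: "0 < e"
  let ?K = "M - ball (foot z) e"
  show "\<exists>d>0. \<forall>z'\<in>{z \<in> Rn D. infdist z M < \<tau>}. dist z' z < d \<longrightarrow> dist (foot z') (foot z) < e"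
  proof (cases "?K = {}")
    case True
    then show ?thesis using foot(1) by (auto intro!: exI[of _ 1] simp: subset_iff dist_commute)
  next
    case False
    have "compact ?K" using compact_M by (simp add: compact_diff)
    then obtain k where k: "k \<in> ?K" "\<And>y. y \<in> ?K \<Longrightarrow> dist z k \<le> dist z y"
      using continuous_attains_inf[OF _ False, of "dist z"]
        continuous_on_dist[OF continuous_on_const continuous_on_id] by blast
    have "infdist z M < dist z k"
    proof (rule ccontr)
      assume "\<not> infdist z M < dist z k"
      then have "foot z = k" using foot_eqI[of z k] z k(1) by auto
      then show False using k(1) e by auto
    qed
    then have gap: "0 < (dist z k - infdist z M) / 2" by simp
    show ?thesis
    proof (intro exI[of _ "(dist z k - infdist z M) / 2"] conjI gap ballI impI)
      fix z' assume z': "dist z' z < (dist z k - infdist z M) / 2"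
      show "dist (foot z') (foot z) < e"
      proof (rule ccontr)
        assume "\<not> dist (foot z') (foot z) < e"
        then have "dist z k \<le> dist z (foot z')"
          using foot(1) by (intro k(2)) (auto simp: dist_commute)
        also have "\<dots> \<le> dist z z' + dist z' (foot z')" by (rule dist_triangle)
        also have "\<dots> \<le> dist z z' + (infdist z M + dist z z')"
          using foot(2)[of z'] infdist_triangle[of z' M z] by (simp add: dist_commute)
        finally show False using z' by (simp add: dist_commute)
      qed
    qed
  qed
qed

lemma ray_add_in_Rn: "x \<in> M \<Longrightarrow> n \<in> Rn D \<Longrightarrow> x + s *\<^sub>R n \<in> Rn D"
  using M_Rn by (auto intro!: subspace_add[OF subspace_Rn] subspace_scale[OF subspace_Rn])

lemma normal_ray_shorten:
  assumes "x \<in> M" "norm n = 1" "0 \<le> s" "s \<le> s'" "infdist (x + s' *\<^sub>R n) M = s'"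
  shows "infdist (x + s *\<^sub>R n) M = s"
proof (rule antisym)
  show "infdist (x + s *\<^sub>R n) M \<le> s"
    using infdist_le[OF assms(1), of "x + s *\<^sub>R n"] assms by (simp add: dist_norm)
  have "x + s' *\<^sub>R n - (x + s *\<^sub>R n) = (s' - s) *\<^sub>R n" by (simp add: algebra_simps)
  then have "dist (x + s' *\<^sub>R n) (x + s *\<^sub>R n) = s' - s"
    unfolding dist_norm using assms by simp
  then show "s \<le> infdist (x + s *\<^sub>R n) M"
    using infdist_triangle[of "x + s' *\<^sub>R n" M "x + s *\<^sub>R n"] assms by simp
qed

text \<open>
A segment along which \<open>x\<close> stays the nearest point can be prolonged as long as it is shorter than
\<open>\<tau>\<close>. Federer obtains this from an ordinary differential equation. Here Brouwer's theorem is applied to the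
map that moves each point by \<open>\<epsilon>\<close> towards its nearest point: the point that is moved onto the end of
the segment lies on its prolongation.
\<close>

lemma normal_ray_extend:
  assumes x: "x \<in> M" and n: "n \<in> Rn D" "norm n = 1" and s: "0 < s" "s < \<tau>"
    and ray: "infdist (x + s *\<^sub>R n) M = s"
  obtains \<epsilon> where "0 < \<epsilon>" "infdist (x + (s + \<epsilon>) *\<^sub>R n) M = s + \<epsilon>"
proof -
  define c where "c = x + s *\<^sub>R n"
  define \<epsilon> where "\<epsilon> = min s (\<tau> - s) / 4"
  have e: "0 < \<epsilon>" "4 * \<epsilon> \<le> s" "4 * \<epsilon> \<le> \<tau> - s" using s by (auto simp: \<epsilon>_def)
  have c: "c \<in> Rn D" "infdist c M = s" using ray x n ray_add_in_Rn by (auto simp: c_def)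
  have tube: "s - 2 * \<epsilon> \<le> infdist z M" "infdist z M \<le> s + 2 * \<epsilon>" if "dist c z \<le> 2 * \<epsilon>" for z
    using infdist_triangle[of c M z] infdist_triangle[of z M c] c(2) that by (auto simp: dist_commute)
  define G where "G z = z - \<epsilon> *\<^sub>R sgn (z - foot z)" for z
  have "continuous_on (Rn D \<inter> cball c (2 * \<epsilon>)) G"
    unfolding G_def
  proof (intro continuous_intros)
    show "continuous_on (Rn D \<inter> cball c (2 * \<epsilon>)) foot"
      by (rule continuous_on_subset[OF continuous_on_foot]) (use tube e s in fastforce)
    show "\<forall>z\<in>Rn D \<inter> cball c (2 * \<epsilon>). z - foot z \<noteq> 0"
    proof
      fix z assume "z \<in> Rn D \<inter> cball c (2 * \<epsilon>)"
      then have "0 < dist z (foot z)" using tube(1)[of z] foot(2)[of z] e s by simp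
      then show "z - foot z \<noteq> 0" by auto
    qed
  qed
  moreover have "G ` (Rn D \<inter> cball c (2 * \<epsilon>)) \<subseteq> Rn D"
    unfolding G_def sgn_div_norm using foot(1) M_Rn
    by (auto intro!: subspace_diff[OF subspace_Rn] subspace_scale[OF subspace_Rn])
  moreover have "\<And>z. norm (G z - z) \<le> \<epsilon>"
    unfolding G_def using e by (simp add: norm_sgn)
  \<comment> \<open>The point \<open>z\<close> is moved onto \<open>c\<close> along the segment from \<open>z\<close> to its nearest point, so \<open>z\<close> and
    \<open>c\<close> share their nearest point \<open>x\<close> and \<open>z\<close> lies on the ray beyond \<open>c\<close>.\<close>
  ultimately obtain z where z: "z \<in> Rn D" "dist c z \<le> 2 * \<epsilon>" "G z = c"
    using near_identity_covers_center[of D "2 * \<epsilon>" c G \<epsilon> thesis] D_pos c(1) e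
    by (smt (verit) near_identity_covers_center)
  define \<delta> where "\<delta> = infdist z M"
  define \<nu> where "\<nu> = sgn (z - foot z)"
  have \<delta>: "norm (z - foot z) = \<delta>" "2 * \<epsilon> \<le> \<delta>"
    using foot(2)[of z] tube(1)[OF z(2)] e by (auto simp: \<delta>_def dist_norm)
  then have \<nu>: "norm \<nu> = 1" "z - foot z = \<delta> *\<^sub>R \<nu>"
    using e by (auto simp: \<nu>_def norm_sgn sgn_div_norm)
  have zc: "z = c + \<epsilon> *\<^sub>R \<nu>" using z(3) by (simp add: G_def \<nu>_def algebra_simps)
  have cf: "c - foot z = (\<delta> - \<epsilon>) *\<^sub>R \<nu>"
    using \<nu>(2) zc by (simp add: algebra_simps)
  have le: "\<delta> \<le> s + \<epsilon>"
    using infdist_triangle[of z M c] c(2) e \<nu>(1) by (simp add: \<delta>_def zc dist_norm)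
  have "dist c (foot z) = \<delta> - \<epsilon>" unfolding dist_norm cf using \<nu> \<delta> e by simp
  then have "foot c = foot z" using foot_eqI[of c "foot z"] foot(1) c s le by auto
  moreover have "foot c = x"
    using foot_eqI[of c x] c s x n by (auto simp: c_def dist_norm)
  ultimately have "foot z = x" by simp
  then have eq: "s *\<^sub>R n = (\<delta> - \<epsilon>) *\<^sub>R \<nu>" using cf by (simp add: c_def)
  then have "s = \<delta> - \<epsilon>"
    using \<delta> e s n(2) \<nu>(1) by (smt (verit) eq mult_cancel_left2 norm_scaleR)
  with eq have "\<nu> = n" using s by simp
  then have "z = x + (s + \<epsilon>) *\<^sub>R n" using zc by (simp add: c_def algebra_simps)
  moreover have "\<delta> = s + \<epsilon>" using \<open>s = \<delta> - \<epsilon>\<close> by simp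
  ultimately show thesis using that[of \<epsilon>] e(1) by (simp add: \<delta>_def)
qed

lemma normal_ray_to_reach:
  assumes x: "x \<in> M" and n: "n \<in> Rn D" "norm n = 1"
    and s0: "0 < s0" "infdist (x + s0 *\<^sub>R n) M = s0" and s: "0 \<le> s" "s < \<tau>"
  shows "infdist (x + s *\<^sub>R n) M = s"
proof (cases "s \<le> s0")
  case True
  then show ?thesis using normal_ray_shorten[OF x n(2) s(1) _ s0(2)] by simp
next
  case False
  let ?J = "{r \<in> {s0..s}. infdist (x + r *\<^sub>R n) M = r}"
  have "closed ?J" 
  proof -
    have "?J = {s0..s} \<inter> {r. infdist (x + r *\<^sub>R n) M = r}" by auto
    moreover have "closed {r. infdist (x + r *\<^sub>R n) M = r}"
      by (intro closed_Collect_eq continuous_intros)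
    ultimately show ?thesis by (simp add: closed_Int)
  qed
  then have "compact ?J"
    by (auto simp: compact_eq_bounded_closed intro: bounded_subset[of "{s0..s}"])
  moreover have "s0 \<in> ?J" using s0 False by auto
  ultimately obtain m where m: "m \<in> ?J" and max: "\<And>r. r \<in> ?J \<Longrightarrow> r \<le> m"
    using compact_attains_sup[of ?J] by auto
  have "m = s"
  proof (rule ccontr)
    assume "m \<noteq> s"
    then have ms: "m < s" "0 < m" using m s0 by auto
    obtain \<epsilon> where e: "0 < \<epsilon>" "infdist (x + (m + \<epsilon>) *\<^sub>R n) M = m + \<epsilon>"
      using normal_ray_extend[OF x n, of m] ms s m by auto
    have "min (m + \<epsilon>) s \<in> ?J"
      using normal_ray_shorten[OF x n(2) _ _ e(2), of "min (m + \<epsilon>) s"] m ms e s by auto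
    then show False using max ms e by fastforce
  qed
  then show ?thesis using m by simp
qed

text \<open>
Federer's inequality: the open ball of radius \<open>\<tau>\<close> around \<open>x + \<tau> n\<close>, which touches \<open>M\<close> at \<open>x\<close>, contains
no point of \<open>M\<close>. The quadratic bound \<open>K\<close> shows this for a small ball touching at \<open>x\<close>, and that ball can
be enlarged up to radius \<open>\<tau>\<close> by prolonging the normal ray.
\<close>

lemma inner_normal_le:
  assumes x: "x \<in> M" and n: "n \<in> Rn D" "norm n = 1"
    and K: "0 < K" "\<And>y. y \<in> M \<Longrightarrow> (y - x) \<bullet> n \<le> K * (norm (y - x))\<^sup>2" and y: "y \<in> M"
  shows "2 * \<tau> * ((y - x) \<bullet> n) \<le> (norm (y - x))\<^sup>2"
proof -
  have expand: "(norm (y - (x + s *\<^sub>R n)))\<^sup>2 = (norm (y - x))\<^sup>2 - 2 * s * ((y - x) \<bullet> n) + s\<^sup>2" for y s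
  proof -
    have "n \<bullet> n = 1" using n(2) by (simp add: power2_norm_eq_inner[symmetric])
    then show ?thesis
      by (simp only: power2_norm_eq_inner)
        (simp add: inner_diff_left inner_diff_right inner_add_left inner_add_right inner_commute
          algebra_simps power2_eq_square)
  qed
  \<comment> \<open>At height \<open>s0\<close> the quadratic bound alone keeps \<open>M\<close> out of the ball around \<open>x + s0 n\<close>.\<close>
  define s0 where "s0 = 1 / (2 * K)"
  have s0: "0 < s0" using K by (simp add: s0_def)
  have "s0 \<le> infdist (x + s0 *\<^sub>R n) M"
  proof -
    let ?f = "foot (x + s0 *\<^sub>R n)"
    have "2 * s0 * ((?f - x) \<bullet> n) \<le> (norm (?f - x))\<^sup>2"
      using K(2)[of ?f] foot(1) K(1) by (simp add: s0_def field_simps)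
    then have "s0\<^sup>2 \<le> (norm (?f - (x + s0 *\<^sub>R n)))\<^sup>2" by (simp add: expand)
    then have "s0 \<le> norm (?f - (x + s0 *\<^sub>R n))" using s0 by (simp add: abs_le_square_iff[symmetric])
    then show ?thesis using foot(2)[of "x + s0 *\<^sub>R n"] by (simp add: dist_norm norm_minus_commute)
  qed
  moreover have "infdist (x + s0 *\<^sub>R n) M \<le> s0"
    using infdist_le[OF x, of "x + s0 *\<^sub>R n"] n s0 by (simp add: dist_norm)
  ultimately have ray0: "infdist (x + s0 *\<^sub>R n) M = s0" by simp
  have le: "2 * s * ((y - x) \<bullet> n) \<le> (norm (y - x))\<^sup>2" if "0 \<le> s" "s < \<tau>" for s
  proof -
    have "s \<le> norm (y - (x + s *\<^sub>R n))"
      using normal_ray_to_reach[OF x n s0 ray0 that] infdist_le[OF y, of "x + s *\<^sub>R n"]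
      by (simp add: dist_norm norm_minus_commute)
    then have "s\<^sup>2 \<le> (norm (y - (x + s *\<^sub>R n)))\<^sup>2" using that by (intro power_mono) auto
    then show ?thesis by (simp add: expand)
  qed
  have "((\<lambda>s. 2 * s * ((y - x) \<bullet> n)) \<longlongrightarrow> 2 * \<tau> * ((y - x) \<bullet> n)) (at_left \<tau>)"
    by (intro tendsto_intros)
  moreover have "\<forall>\<^sub>F s in at_left \<tau>. 2 * s * ((y - x) \<bullet> n) \<le> (norm (y - x))\<^sup>2"
    using eventually_at_left_real[OF tau_pos] by eventually_elim (use le in auto)
  ultimately show ?thesis
    by (rule tendsto_upperbound) auto
qed

end

section \<open>Tangent frames from charts of class two\<close>

lemma expand_Rn: "v \<in> Rn d \<Longrightarrow> v = (\<Sum>i<d. coord v i *\<^sub>R unit_fseq i)"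
  using vec_of_coord[of v d] by (simp add: vec_of_def)

lemma unit_fseq_in_Rn: "i < d \<Longrightarrow> unit_fseq i \<in> Rn d"
  by (simp add: Rn_def coord_unit_fseq)

lemma span_unit_fseq: "span (unit_fseq ` {..<d}) = Rn d"
proof
  show "span (unit_fseq ` {..<d}) \<subseteq> Rn d"
    by (rule span_minimal) (auto simp: unit_fseq_in_Rn subspace_Rn)
  show "Rn d \<subseteq> span (unit_fseq ` {..<d})"
  proof
    fix v assume "v \<in> Rn d"
    then show "v \<in> span (unit_fseq ` {..<d})"
      by (subst expand_Rn[of v d]) (auto intro: span_base intro!: span_sum span_scale)
  qed
qed

lemma inner_unit_fseq: "unit_fseq i \<bullet> unit_fseq j = (if i = j then 1 else 0)"
proof -
  have "unit_fseq i \<bullet> unit_fseq j = (\<Sum>k<Suc i. coord (unit_fseq i) k * coord (unit_fseq j) k)"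
    by (rule inner_Rn) (simp add: unit_fseq_in_Rn)
  also have "\<dots> = (\<Sum>k<Suc i. if k = i then coord (unit_fseq j) i else 0)"
    by (intro sum.cong) (auto simp: coord_unit_fseq)
  finally show ?thesis by (simp add: coord_unit_fseq)
qed

lemma independent_unit_fseq: "independent (unit_fseq ` {..<d})" "card (unit_fseq ` {..<d}) = d"
proof -
  have inj: "inj unit_fseq"
  proof (rule injI)
    fix i j assume "unit_fseq i = unit_fseq j"
    then show "i = j" using inner_unit_fseq[of i i] inner_unit_fseq[of i j] by (simp split: if_splits)
  qed
  have "unit_fseq i \<noteq> 0" for i using inner_unit_fseq[of i i] by auto
  then show "independent (unit_fseq ` {..<d})"
    by (intro pairwise_orthogonal_independent)
      (auto simp: pairwise_def orthogonal_def inner_unit_fseq)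
  show "card (unit_fseq ` {..<d}) = d"
    using card_image[OF inj_on_subset[OF inj]] by simp
qed

text \<open>
The image of \<open>A\<close> on \<open>\<real>\<^sup>d\<close> is the candidate for the tangent space; Gram-Schmidt is applied to the images
of the unit vectors.
\<close>

lemma orthonormal_basis_of_image:
  assumes lin: "linear A" and inj: "\<And>v. v \<in> Rn d \<Longrightarrow> A v = 0 \<Longrightarrow> v = 0"
  obtains b :: "nat \<Rightarrow> fseq" where
    "\<And>i j. i < d \<Longrightarrow> j < d \<Longrightarrow> b i \<bullet> b j = (if i = j then 1 else 0)" "span (b ` {..<d}) = A ` Rn d"
proof -
  let ?E = "unit_fseq ` {..<d}"
  let ?B = "A ` ?E"
  have inj_on: "inj_on A (Rn d)"
  proof (rule inj_onI)
    fix x y assume "x \<in> Rn d" "y \<in> Rn d" "A x = A y"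
    then show "x = y" using inj[of "x - y"] linear_diff[OF lin, of x y] subspace_diff[OF subspace_Rn] by auto
  qed
  have "independent ?B"
    by (rule linear_independent_injective_image[OF lin independent_unit_fseq(1)])
      (simp add: span_unit_fseq inj_on)
  moreover have "card ?B = d"
    using card_image[OF inj_on_subset[OF inj_on, of ?E]] independent_unit_fseq(2) unit_fseq_in_Rn by auto
  ultimately have dimB: "dim ?B = d" by (metis dim_eq_card_independent)
  obtain C where C: "finite C" "span C = span ?B" "pairwise orthogonal C"
    using basis_orthogonal[of ?B] by auto
  let ?C = "C - {0}"
  have "pairwise orthogonal ?C" using C(3) by (rule pairwise_mono) auto
  then have ind: "independent ?C" by (rule pairwise_orthogonal_independent) simp
  have span: "span ?C = span ?B" using C(2) by (simp add: span_delete_0)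
  have "card ?C = d"
    using dim_eq_card_independent[OF ind] span dimB by (metis dim_span)
  then obtain g where g: "bij_betw g {..<d} ?C"
    using C(1) by (metis bij_betw_iff_card finite_Diff finite_lessThan card_lessThan)
  define b where "b i = g i /\<^sub>R norm (g i)" for i
  have gnz: "g i \<noteq> 0" "g i \<in> ?C" if "i < d" for i using g that by (auto simp: bij_betw_def)
  have "b i \<bullet> b j = (if i = j then 1 else 0)" if "i < d" "j < d" for i j
  proof (cases "i = j")
    case True
    then show ?thesis using gnz[OF that(1)]
      by (simp add: b_def dot_square_norm power2_eq_square field_simps)
  next
    case False
    then have "g i \<noteq> g j" using g that by (auto simp: bij_betw_def inj_on_def)
    then have "orthogonal (g i) (g j)"
      using C(3) gnz that by (auto simp: pairwise_def)
    then show ?thesis using False by (simp add: b_def orthogonal_def)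
  qed
  moreover have "span (b ` {..<d}) = A ` Rn d"
  proof -
    have gb: "g i = norm (g i) *\<^sub>R b i" if "i < d" for i using gnz[OF that] by (simp add: b_def)
    have "span (b ` {..<d}) = span ?C"
    proof (rule subset_antisym; rule span_minimal)
      show "b ` {..<d} \<subseteq> span ?C" using gnz by (auto simp: b_def intro: span_base intro!: span_scale)
      show "?C \<subseteq> span (b ` {..<d})"
      proof
        fix c assume "c \<in> ?C"
        then obtain i where "i < d" "c = g i" using g by (auto simp: bij_betw_def)
        then have "b i \<in> span (b ` {..<d})" by (auto intro: span_base)
        then show "c \<in> span (b ` {..<d})" 
          using span_scale[of "b i" "b ` {..<d}" "norm (g i)"] gb[OF \<open>i < d\<close>] \<open>c = g i\<close> by simp
      qed
    qed auto
    also have "\<dots> = A ` span ?E" using span linear_span_image[OF lin] by simp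
    finally show ?thesis by (simp add: span_unit_fseq)
  qed
  ultimately show thesis by (rule that)
qed

lemma orthonormal_expand:
  fixes b :: "nat \<Rightarrow> 'a::real_inner"
  assumes on: "\<And>i j. i < d \<Longrightarrow> j < d \<Longrightarrow> b i \<bullet> b j = (if i = j then 1 else (0::real))"
    and w: "w \<in> span (b ` {..<d})"
  shows "w = (\<Sum>i<d. (w \<bullet> b i) *\<^sub>R b i)"
proof -
  have inj: "inj_on b {..<d}"
  proof (rule inj_onI)
    fix i j assume "i \<in> {..<d}" "j \<in> {..<d}" "b i = b j"
    then show "i = j" using on[of i i] on[of i j] by (simp split: if_splits)
  qed
  have "w \<in> range (\<lambda>u. \<Sum>v\<in>b ` {..<d}. u v *\<^sub>R v)"
    using w unfolding span_finite[OF finite_imageI[OF finite_lessThan]] .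
  then obtain u where "w = (\<Sum>v\<in>b ` {..<d}. u v *\<^sub>R v)" by (rule rangeE)
  then have u: "w = (\<Sum>i<d. u (b i) *\<^sub>R b i)" by (simp add: sum.reindex[OF inj])
  have "w \<bullet> b j = u (b j)" if "j < d" for j
  proof -
    have "w \<bullet> b j = (\<Sum>i<d. u (b i) * (b i \<bullet> b j))" by (subst u) (simp add: inner_sum_left)
    also have "\<dots> = (\<Sum>i<d. if i = j then u (b j) else 0)" by (intro sum.cong) (auto simp: on that)
    finally show ?thesis using that by simp
  qed
  then have "(\<Sum>i<d. (w \<bullet> b i) *\<^sub>R b i) = (\<Sum>i<d. u (b i) *\<^sub>R b i)" by (intro sum.cong) auto
  then show ?thesis using u by simp
qed

text \<open>
The vectors \<open>b i\<close> span a \<open>d\<close>-dimensional space of tangent vectors. The last clause says that \<open>M\<close> leaves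
the affine plane through \<open>x\<close> in these directions at most quadratically.
\<close>

definition tangent_frame :: "nat \<Rightarrow> nat \<Rightarrow> fseq set \<Rightarrow> fseq \<Rightarrow> (nat \<Rightarrow> fseq) \<Rightarrow> bool" where
  "tangent_frame D d M x b \<longleftrightarrow>
     (\<forall>i<d. \<forall>j<d. b i \<bullet> b j = (if i = j then 1 else 0)) \<and>
     (\<forall>c. (\<Sum>i<d. c i *\<^sub>R b i) \<in> tangent_space M x) \<and>
     (\<exists>K>0. \<forall>n\<in>Rn D. norm n = 1 \<longrightarrow> (\<forall>i<d. n \<bullet> b i = 0) \<longrightarrow>
        (\<forall>y\<in>M. (y - x) \<bullet> n \<le> K * (norm (y - x))\<^sup>2))"

text \<open>
Derivatives within the chart domain are determined only in the directions of \<open>\<real>\<^sup>d\<close>. Restricting to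
lines in these directions gives ordinary derivatives at interior points.
\<close>

lemma has_vector_derivative_along_line:
  assumes V: "openin (top_of_set (Rn d)) V" and v: "v \<in> Rn d" "a + s *\<^sub>R v \<in> V" "a \<in> Rn d"
    and der: "(f has_derivative A) (at (a + s *\<^sub>R v) within V)"
  shows "((\<lambda>t. f (a + t *\<^sub>R v)) has_vector_derivative A v) (at s)"
proof -
  obtain O' where O': "open O'" "V = Rn d \<inter> O'" using V by (auto simp: openin_open)
  let ?T = "{t. a + t *\<^sub>R v \<in> O'}"
  have "open ?T" 
    using open_vimage[OF O'(1), of "\<lambda>t. a + t *\<^sub>R v"] by (simp add: vimage_def continuous_intros)
  have line: "a + t *\<^sub>R v \<in> Rn d" for t
    using v by (intro subspace_add[OF subspace_Rn] subspace_scale[OF subspace_Rn])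
  have "((\<lambda>t. a + t *\<^sub>R v) has_derivative (\<lambda>t. t *\<^sub>R v)) (at s within ?T)"
    by (auto intro!: derivative_eq_intros)
  moreover have "(f has_derivative A) (at (a + s *\<^sub>R v) within (\<lambda>t. a + t *\<^sub>R v) ` ?T)"
    by (rule has_derivative_subset[OF der]) (use O' line in auto)
  ultimately have "(f \<circ> (\<lambda>t. a + t *\<^sub>R v) has_derivative A \<circ> (\<lambda>t. t *\<^sub>R v)) (at s within ?T)"
    by (rule diff_chain_within)
  moreover have "A \<circ> (\<lambda>t. t *\<^sub>R v) = (\<lambda>t. t *\<^sub>R A v)"
    using has_derivative_linear[OF der] by (auto simp: linear_scale)
  ultimately show ?thesis
    using at_within_open[of s ?T] \<open>open ?T\<close> v O' by (simp add: has_vector_derivative_def o_def)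
qed

text \<open>
Here \<open>C\<^sup>2\<close> enters: a chart \<open>\<psi>\<close> satisfies \<open>\<psi> x = p + A (x - a) + O(|x - a|\<^sup>2)\<close>, the linear part is
killed by normal vectors, and \<open>|x - a|\<close> is comparable to \<open>|\<psi> x - p|\<close> because \<open>\<psi>\<close> is an immersion.
\<close>

lemma C2_tangent_frame:
  assumes C2: "C2_submanifold D d M" and p: "p \<in> M"
  shows "\<exists>b. tangent_frame D d M p b"
proof -
  obtain U V \<psi> \<phi> where U: "open U" "p \<in> U" and V: "openin (top_of_set (Rn d)) V"
    and hom: "homeomorphism V (M \<inter> U) \<psi> \<phi>" and Ck: "Ck_on (Rn d) 2 V \<psi>"
    and imm: "\<forall>x\<in>V. \<exists>A. (\<psi> has_derivative A) (at x within V) \<and> (\<forall>v\<in>Rn d. A v = 0 \<longrightarrow> v = 0)"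
    using C2 p unfolding C2_submanifold_def by blast
  obtain f' where f': "\<And>x. x \<in> V \<Longrightarrow> (\<psi> has_derivative f' x) (at x within V)"
    and f'C1: "\<And>v. v \<in> Rn d \<Longrightarrow> Ck_on (Rn d) 1 V (\<lambda>x. f' x v)"
    using Ck by (auto simp: numeral_2_eq_2)
  obtain f'' where f'': "\<And>v x. v \<in> Rn d \<Longrightarrow> x \<in> V \<Longrightarrow> ((\<lambda>x. f' x v) has_derivative f'' v x) (at x within V)"
    using f'C1 unfolding One_nat_def Ck_on.simps by metis
  define a where "a = \<phi> p"
  have a: "a \<in> V" "\<psi> a = p" using hom p U by (auto simp: a_def homeomorphism_def)
  have VRn: "V \<subseteq> Rn d" using V by (auto simp: openin_open)
  then have aRn: "a \<in> Rn d" using a by auto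
  define A where "A = f' a"
  have lin: "linear A" unfolding A_def using f'[OF a(1)] by (rule has_derivative_linear)
  have injA: "v = 0" if v: "v \<in> Rn d" "A v = 0" for v
  proof -
    obtain B where B: "(\<psi> has_derivative B) (at a within V)" "\<forall>v\<in>Rn d. B v = 0 \<longrightarrow> v = 0"
      using bspec[OF imm a(1)] by (elim exE conjE) rule
    have "((\<lambda>t. \<psi> (a + t *\<^sub>R v)) has_vector_derivative f' a v) (at 0)"
      "((\<lambda>t. \<psi> (a + t *\<^sub>R v)) has_vector_derivative B v) (at 0)"
      using has_vector_derivative_along_line[OF V v(1), of a 0 \<psi>] B(1) f'[OF a(1)] a(1) aRn by simp_all
    then have "A v = B v"
      unfolding A_def by (rule vector_derivative_unique_at)
    then show ?thesis using B(2) v by auto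
  qed
  obtain b where on: "\<And>i j. i < d \<Longrightarrow> j < d \<Longrightarrow> b i \<bullet> b j = (if i = j then 1 else 0)"
    and span: "span (b ` {..<d}) = A ` Rn d"
    using orthonormal_basis_of_image[OF lin injA] by blast
  have bin: "b i \<in> A ` Rn d" if "i < d" for i
    using span_base[of "b i" "b ` {..<d}"] that unfolding span by simp
  have combo: "(\<Sum>i<d. c i *\<^sub>R b i) \<in> A ` Rn d" for c
    unfolding span[symmetric] by (rule span_sum, rule span_scale, rule span_base) simp
  \<comment> \<open>An injective linear map on a finite-dimensional space expands lengths by a positive factor: here
    preimages \<open>u i\<close> of the orthonormal vectors give the factor \<open>1 / m\<close>.\<close>
  obtain u where u: "\<And>i. i < d \<Longrightarrow> u i \<in> Rn d" "\<And>i. i < d \<Longrightarrow> A (u i) = b i"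
  proof -
    have "\<forall>i. \<exists>v. i < d \<longrightarrow> v \<in> Rn d \<and> A v = b i"
      using bin by (force simp: image_iff)
    then show thesis using that by metis
  qed
  define m where "m = 1 + (\<Sum>i<d. norm (u i))"
  have m: "0 < m" unfolding m_def by (auto intro!: add_pos_nonneg sum_nonneg)
  have lower: "norm v \<le> m * norm (A v)" if v: "v \<in> Rn d" for v
  proof -
    have nb: "norm (b i) = 1" if "i < d" for i
      using on[of i i] that by (simp add: norm_eq_sqrt_inner)
    let ?w = "\<Sum>i<d. (A v \<bullet> b i) *\<^sub>R u i"
    have "A v = (\<Sum>i<d. (A v \<bullet> b i) *\<^sub>R b i)"
      by (rule orthonormal_expand[OF on]) (use span v in auto)
    also have "\<dots> = A ?w"
      by (simp add: linear_sum[OF lin] linear_scale[OF lin] u)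
    finally have "A (v - ?w) = 0" by (simp add: linear_diff[OF lin])
    moreover have "v - ?w \<in> Rn d"
      using v u by (intro subspace_diff[OF subspace_Rn] subspace_sum[OF subspace_Rn] subspace_scale[OF subspace_Rn]) auto
    ultimately have "v = ?w" using injA by fastforce
    then have "norm v = norm ?w" by simp
    also have "\<dots> \<le> (\<Sum>i<d. norm (A v) * norm (u i))"
    proof (rule sum_norm_le)
      fix i assume "i \<in> {..<d}"
      then have "\<bar>A v \<bullet> b i\<bar> \<le> norm (A v)"
        using Cauchy_Schwarz_ineq2[of "A v" "b i"] nb by simp
      then show "norm ((A v \<bullet> b i) *\<^sub>R u i) \<le> norm (A v) * norm (u i)"
        by (simp add: mult_right_mono)
    qed
    also have "\<dots> \<le> m * norm (A v)"
      by (simp add: m_def sum_distrib_left[symmetric] algebra_simps)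
    finally show ?thesis .
  qed
  obtain O' where O': "open O'" "V = Rn d \<inter> O'" using V by (auto simp: openin_open)
  then obtain r0 where r0: "0 < r0" "ball a r0 \<subseteq> O'" using a by (metis IntE open_contains_ball)
  have inV: "x \<in> V" if "x \<in> Rn d" "dist a x < r0" for x using that r0 O' by auto
  have line: "a + t *\<^sub>R v \<in> Rn d" if "v \<in> Rn d" for t v
    using that aRn by (intro subspace_add[OF subspace_Rn] subspace_scale[OF subspace_Rn])
  have tangent: "A v \<in> tangent_space M p" if v: "v \<in> Rn d" for v
  proof -
    define e where "e = r0 / (norm v + 1)"
    have e: "0 < e" using r0 by (simp add: e_def add_nonneg_pos)
    have "a + t *\<^sub>R v \<in> V" if "t \<in> {-e<..<e}" for t
    proof (rule inV[OF line[OF v]])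
      have "\<bar>t\<bar> * norm v \<le> \<bar>t\<bar> * (norm v + 1)" by (intro mult_left_mono) auto
      also have "\<dots> < e * (norm v + 1)" using that by (intro mult_strict_right_mono) (auto simp: add_nonneg_pos)
      also have "\<dots> = r0" by (simp add: e_def add_nonneg_eq_0_iff)
      finally show "dist a (a + t *\<^sub>R v) < r0" by (simp add: dist_norm)
    qed
    note t = this
    show ?thesis unfolding tangent_space_def
    proof (intro CollectI exI conjI)
      show "0 < e" by (fact e)
      have "\<forall>t\<in>{-e<..<e}. ((\<lambda>t. \<psi> (a + t *\<^sub>R v)) has_vector_derivative f' (a + t *\<^sub>R v) v) (at t)"
        using has_vector_derivative_along_line[OF V v] t f' aRn by blast
      moreover have "continuous_on {-e<..<e} (\<lambda>t. f' (a + t *\<^sub>R v) v)"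
      proof (rule continuous_on_compose2[of V "\<lambda>x. f' x v"])
        show "continuous_on V (\<lambda>x. f' x v)"
          using f''[OF v] has_derivative_continuous_on by blast
      qed (use t in \<open>auto intro!: continuous_intros\<close>)
      ultimately show "(\<lambda>t. \<psi> (a + t *\<^sub>R v)) C1_differentiable_on {-e<..<e}"
        unfolding C1_differentiable_on_def
        by (intro exI[of _ "\<lambda>t. f' (a + t *\<^sub>R v) v"] conjI)
      show "(\<lambda>t. \<psi> (a + t *\<^sub>R v)) ` {-e<..<e} \<subseteq> M"
      proof -
        have "\<psi> ` V \<subseteq> M" using hom by (auto simp: homeomorphism_def)
        then show ?thesis using t by blast
      qed
      show "((\<lambda>t. \<psi> (a + t *\<^sub>R v)) has_vector_derivative A v) (at 0)"
        using has_vector_derivative_along_line[OF V v, of a 0 \<psi> A] f'[OF a(1)] a(1) aRn by (simp add: A_def)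
    qed (simp add: a)
  qed
  \<comment> \<open>Second differentiability at \<open>a\<close>, applied to each basis vector, makes the first derivative
    Lipschitz at \<open>a\<close>.\<close>
  have "\<exists>C r. 0 < r \<and> (\<forall>x\<in>V. dist a x < r \<longrightarrow> norm (f' x (unit_fseq i) - A (unit_fseq i)) \<le> C * dist a x)"
    if "i < d" for i
  proof -
    let ?e = "unit_fseq i"
    have der: "((\<lambda>x. f' x ?e) has_derivative f'' ?e a) (at a within V)"
      using f''[of ?e a] unit_fseq_in_Rn that a by auto
    obtain B where B: "\<And>h. norm (f'' ?e a h) \<le> norm h * B"
      using bounded_linear.bounded[OF has_derivative_bounded_linear[OF der]] by blast
    obtain r where r: "r > 0" "\<And>x. x \<in> V \<Longrightarrow> norm (x - a) < r \<Longrightarrow>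
        norm (f' x ?e - f' a ?e - f'' ?e a (x - a)) \<le> 1 * norm (x - a)"
      using der unfolding has_derivative_within_alt by (metis zero_less_one)
    have "norm (f' x ?e - A ?e) \<le> (B + 1) * dist a x" if "x \<in> V" "dist a x < r" for x
    proof -
      have "norm (f' x ?e - A ?e) \<le> norm (f' x ?e - f' a ?e - f'' ?e a (x - a)) + norm (f'' ?e a (x - a))"
        unfolding A_def by (metis diff_add_cancel norm_triangle_ineq)
      also have "\<dots> \<le> norm (x - a) + norm (x - a) * B"
        using r(2)[of x] B[of "x - a"] that by (simp add: dist_norm norm_minus_commute)
      finally show ?thesis by (simp add: dist_norm norm_minus_commute algebra_simps)
    qed
    then show ?thesis using r by blast
  qed
  then obtain C r where Cr: "\<And>i. i < d \<Longrightarrow> 0 < r i" "\<And>i x. i < d \<Longrightarrow> x \<in> V \<Longrightarrow> dist a x < r i \<Longrightarrow>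
      norm (f' x (unit_fseq i) - A (unit_fseq i)) \<le> C i * dist a x" by metis
  define r1 where "r1 = Min (insert r0 (r ` {..<d}))"
  have r1: "0 < r1" "r1 \<le> r0" "\<And>i. i < d \<Longrightarrow> r1 \<le> r i"
    using Cr(1) r0 by (auto simp: r1_def)
  define C1 where "C1 = (\<Sum>i<d. \<bar>C i\<bar>)"
  have C1: "0 \<le> C1" by (simp add: C1_def sum_nonneg)
  have lip: "norm (f' x v - A v) \<le> C1 * norm v * dist a x" if x: "x \<in> V" "dist a x < r1" and v: "v \<in> Rn d" for x v
  proof -
    have linx: "linear (f' x)" using f'[OF x(1)] by (rule has_derivative_linear)
    have "f' x v - A v = (\<Sum>i<d. coord v i *\<^sub>R (f' x (unit_fseq i) - A (unit_fseq i)))"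
      by (subst (1 2) expand_Rn[OF v])
        (simp add: linear_sum[OF linx] linear_sum[OF lin] linear_scale[OF linx] linear_scale[OF lin]
          sum_subtractf scaleR_diff_right)
    also have "norm \<dots> \<le> (\<Sum>i<d. norm v * (\<bar>C i\<bar> * dist a x))"
    proof (rule sum_norm_le)
      fix i assume i: "i \<in> {..<d}"
      have "norm (f' x (unit_fseq i) - A (unit_fseq i)) \<le> C i * dist a x"
        using Cr(2)[of i x] i x r1(3)[of i] by auto
      also have "\<dots> \<le> \<bar>C i\<bar> * dist a x" by (intro mult_right_mono) auto
      finally show "norm (coord v i *\<^sub>R (f' x (unit_fseq i) - A (unit_fseq i))) \<le> norm v * (\<bar>C i\<bar> * dist a x)"
        using abs_coord_le_norm[of v i] by (simp add: mult_mono)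
    qed
    also have "\<dots> = C1 * norm v * dist a x"
      by (simp add: C1_def sum_distrib_left sum_distrib_right algebra_simps)
    finally show ?thesis .
  qed
  \<comment> \<open>For \<open>n\<close> normal to the image of \<open>A\<close>, the mean value theorem on the segment from \<open>a\<close> to \<open>x\<close>
    turns the Lipschitz bound into a quadratic one.\<close>
  have quad: "(\<psi> x - p) \<bullet> n \<le> C1 * (norm (x - a))\<^sup>2"
    if x: "x \<in> Rn d" "dist a x < r1" and n: "norm n = 1" "\<And>v. v \<in> Rn d \<Longrightarrow> n \<bullet> A v = 0" for x n
  proof -
    define v where "v = x - a"
    have v: "v \<in> Rn d" unfolding v_def using x aRn by (intro subspace_diff[OF subspace_Rn])
    have seg: "a + t *\<^sub>R v \<in> V" "dist a (a + t *\<^sub>R v) < r1" "dist a (a + t *\<^sub>R v) \<le> norm v"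
      if "0 \<le> t" "t \<le> 1" for t
    proof -
      have "dist a (a + t *\<^sub>R v) \<le> norm v" using that by (simp add: dist_norm mult_left_le_one_le)
      moreover have "norm v < r1" using x by (simp add: v_def dist_norm norm_minus_commute)
      ultimately show "a + t *\<^sub>R v \<in> V" "dist a (a + t *\<^sub>R v) < r1" "dist a (a + t *\<^sub>R v) \<le> norm v"
        using inV[OF line[OF v]] r1 by auto
    qed
    define g where "g t = (\<psi> (a + t *\<^sub>R v) - p) \<bullet> n" for t
    have "DERIV g t :> f' (a + t *\<^sub>R v) v \<bullet> n" if "0 \<le> t" "t \<le> 1" for t
    proof -
      have "((\<lambda>t. \<psi> (a + t *\<^sub>R v)) has_derivative (\<lambda>h. h *\<^sub>R f' (a + t *\<^sub>R v) v)) (at t)"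
        using has_vector_derivative_along_line[OF V v seg(1)[OF that] aRn f'[OF seg(1)[OF that]]]
        by (simp add: has_vector_derivative_def)
      then have "(g has_derivative (\<lambda>h. (h *\<^sub>R f' (a + t *\<^sub>R v) v - 0) \<bullet> n)) (at t)"
        unfolding g_def by (intro derivative_intros)
      then show ?thesis unfolding has_field_derivative_def
        by (rule has_derivative_eq_rhs) (auto simp: fun_eq_iff)
    qed
    then obtain t where t: "0 < t" "t < 1" "g 1 - g 0 = (1 - 0) * (f' (a + t *\<^sub>R v) v \<bullet> n)"
      using MVT2[of 0 1 g "\<lambda>t. f' (a + t *\<^sub>R v) v \<bullet> n"] by auto
    have "f' (a + t *\<^sub>R v) v \<bullet> n = (f' (a + t *\<^sub>R v) v - A v) \<bullet> n"
      using n(2)[OF v] by (simp add: inner_diff_left inner_commute[of "A v"])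
    also have "\<dots> \<le> norm (f' (a + t *\<^sub>R v) v - A v)"
      using norm_cauchy_schwarz[of "f' (a + t *\<^sub>R v) v - A v" n] n by simp
    also have "\<dots> \<le> C1 * norm v * dist a (a + t *\<^sub>R v)" 
      by (intro lip seg v) (use t in auto)
    also have "\<dots> \<le> C1 * norm v * norm v" using seg(3)[of t] t C1 by (intro mult_left_mono) auto
    finally show ?thesis using t(3) by (simp add: g_def v_def a power2_eq_square mult.assoc)
  qed
  obtain r2 where r2: "0 < r2" "\<And>x. x \<in> V \<Longrightarrow> norm (x - a) < r2 \<Longrightarrow>
      norm (\<psi> x - \<psi> a - f' a (x - a)) \<le> (1 / (2 * m)) * norm (x - a)"
  proof -
    have "0 < 1 / (2 * m)" using m by simp
    then show thesis using f'[OF a(1)] that unfolding has_derivative_within_alt by blast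
  qed
  \<comment> \<open>Since \<open>\<psi>\<close> expands near \<open>a\<close>, the estimate in terms of \<open>x - a\<close> is also one in terms of
    \<open>\<psi> x - p\<close>.\<close>
  have expanding: "norm (x - a) \<le> 2 * m * norm (\<psi> x - p)" if x: "x \<in> V" "norm (x - a) < r2" for x
  proof -
    have "x - a \<in> Rn d" using x aRn VRn by (intro subspace_diff[OF subspace_Rn]) auto
    then have "norm (x - a) \<le> m * norm (A (x - a))" by (rule lower)
    also have "norm (A (x - a)) \<le> norm (\<psi> x - p) + (1 / (2 * m)) * norm (x - a)"
      using r2(2)[OF x] norm_triangle_ineq4[of "\<psi> x - p" "\<psi> x - p - A (x - a)"] by (simp add: A_def a)
    finally have "norm (x - a) \<le> m * (norm (\<psi> x - p) + (1 / (2 * m)) * norm (x - a))"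
      using m by simp
    then show ?thesis using m by (simp add: field_simps)
  qed
  \<comment> \<open>As \<open>\<phi>\<close> is continuous, all points of \<open>M\<close> near \<open>p\<close> have parameters near \<open>a\<close>; for the
    points at distance at least \<open>\<delta>\<close> the bound holds with constant \<open>1 / \<delta>\<close>.\<close>
  have "continuous_on (M \<inter> U) \<phi>" using hom by (simp add: homeomorphism_def)
  then obtain s where s: "0 < s" "\<And>y. y \<in> M \<inter> U \<Longrightarrow> dist y p < s \<Longrightarrow> dist (\<phi> y) a < min r1 r2"
  proof -
    have "0 < min r1 r2" "p \<in> M \<inter> U" using p U r1(1) r2(1) by auto
    then show thesis
      using \<open>continuous_on (M \<inter> U) \<phi>\<close> that unfolding continuous_on_iff a_def by blast
  qed
  obtain s' where s': "0 < s'" "ball p s' \<subseteq> U" using U by (metis open_contains_ball)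
  define \<delta> where "\<delta> = min s s'"
  have \<delta>: "0 < \<delta>" using s s' by (simp add: \<delta>_def)
  define K where "K = C1 * (2 * m)\<^sup>2 + 1 / \<delta>"
  have Kpos: "0 < K" using C1 \<delta> by (auto simp: K_def intro!: add_nonneg_pos)
  have "(y - p) \<bullet> n \<le> K * (norm (y - p))\<^sup>2"
    if n: "n \<in> Rn D" "norm n = 1" "\<forall>i<d. n \<bullet> b i = 0" and y: "y \<in> M" for n y
  proof (cases "dist y p < \<delta>")
    case True
    then have yU: "y \<in> M \<inter> U" "dist y p < s" using s' y by (auto simp: \<delta>_def dist_commute)
    define x where "x = \<phi> y"
    have x: "x \<in> V" "\<psi> x = y" using hom yU by (auto simp: x_def homeomorphism_def)
    have xa: "dist a x < r1" "norm (x - a) < r2" using s(2)[OF yU] 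
      by (auto simp: x_def dist_norm norm_minus_commute)
    have "n \<bullet> A v = 0" if "v \<in> Rn d" for v
    proof -
      have "A v = (\<Sum>i<d. (A v \<bullet> b i) *\<^sub>R b i)"
        using span that by (intro orthonormal_expand[OF on]) auto
      also have "n \<bullet> \<dots> = 0" using n(3) by (simp add: inner_sum_right)
      finally show ?thesis .
    qed
    moreover have "x \<in> Rn d" using x VRn by auto
    ultimately have "(\<psi> x - p) \<bullet> n \<le> C1 * (norm (x - a))\<^sup>2" using xa(1) n(2) by (intro quad)
    also have "\<dots> \<le> C1 * (2 * m * norm (y - p))\<^sup>2"
      using expanding[OF x(1) xa(2)] C1 x by (intro mult_left_mono power_mono) auto
    also have "\<dots> \<le> K * (norm (y - p))\<^sup>2"
      using \<delta> by (simp add: K_def power_mult_distrib algebra_simps)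
    finally show ?thesis using x by simp
  next
    case False
    have "(y - p) \<bullet> n \<le> norm (y - p)" using norm_cauchy_schwarz[of "y - p" n] n by simp
    also have "\<dots> \<le> (1 / \<delta>) * (norm (y - p))\<^sup>2"
    proof -
      have "\<delta> * norm (y - p) \<le> norm (y - p) * norm (y - p)"
        using False by (intro mult_right_mono) (auto simp: dist_norm)
      then show ?thesis using \<delta> by (simp add: power2_eq_square field_simps)
    qed
    also have "\<dots> \<le> K * (norm (y - p))\<^sup>2"
      using C1 by (intro mult_right_mono) (auto simp: K_def)
    finally show ?thesis .
  qed
  note bound = this
  have in_tangent: "(\<Sum>i<d. c i *\<^sub>R b i) \<in> tangent_space M p" for c
  proof -
    obtain v where "v \<in> Rn d" "(\<Sum>i<d. c i *\<^sub>R b i) = A v" using combo[of c] by (rule imageE)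
    then show ?thesis using tangent[of v] by simp
  qed
  show ?thesis
    unfolding tangent_frame_def
  proof (rule exI[of _ b], intro conjI)
    show "\<forall>i<d. \<forall>j<d. b i \<bullet> b j = (if i = j then 1 else 0)"
      using on by blast
    show "\<forall>c. (\<Sum>i<d. c i *\<^sub>R b i) \<in> tangent_space M p"
      by (intro allI in_tangent)
    show "\<exists>K>0. \<forall>n\<in>Rn D. norm n = 1 \<longrightarrow> (\<forall>i<d. n \<bullet> b i = 0) \<longrightarrow>
        (\<forall>y\<in>M. (y - p) \<bullet> n \<le> K * (norm (y - p))\<^sup>2)"
      using Kpos bound by blast
  qed
qed

section \<open>The distance along tangent rays\<close>

lemma tangent_space_scale:
  assumes "v \<in> tangent_space M x" "0 < c"
  shows "c *\<^sub>R v \<in> tangent_space M x"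
proof -
  obtain \<gamma> e where g: "0 < e" "\<gamma> C1_differentiable_on {-e<..<e}" "\<gamma> ` {-e<..<e} \<subseteq> M" "\<gamma> 0 = x"
    "(\<gamma> has_vector_derivative v) (at 0)"
    using assms(1) by (auto simp: tangent_space_def)
  let ?S = "{-(e/c)<..<e/c}"
  have S: "c * t \<in> {-e<..<e}" if "t \<in> ?S" for t
    using that assms(2) by (auto simp: field_simps)
  obtain D where D: "\<forall>t\<in>{-e<..<e}. (\<gamma> has_vector_derivative D t) (at t)" "continuous_on {-e<..<e} D"
    using g(2) by (auto simp: C1_differentiable_on_def)
  have chain: "((\<lambda>t. \<gamma> (c * t)) has_vector_derivative c *\<^sub>R w) (at t)"
    if "(\<gamma> has_vector_derivative w) (at (c * t))" for w t
  proof -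
    have "((\<lambda>t. c * t) has_vector_derivative c) (at t)"
      by (auto intro!: derivative_eq_intros simp: has_real_derivative_iff_has_vector_derivative[symmetric])
    from vector_diff_chain_at[OF this that] show ?thesis by (simp add: o_def)
  qed
  show ?thesis
    unfolding tangent_space_def
  proof (intro CollectI exI[of _ "\<lambda>t. \<gamma> (c * t)"] exI[of _ "e / c"] conjI)
    show "(\<lambda>t. \<gamma> (c * t)) C1_differentiable_on ?S"
      unfolding C1_differentiable_on_def
    proof (intro exI[of _ "\<lambda>t. c *\<^sub>R D (c * t)"] conjI ballI)
      show "continuous_on ?S (\<lambda>t. c *\<^sub>R D (c * t))"
        by (intro continuous_intros continuous_on_compose2[OF D(2)]) (use S in blast)
    qed (use D(1) S chain in blast)
    show "(\<lambda>t. \<gamma> (c * t)) ` ?S \<subseteq> M" using g(3) S by blast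
    show "((\<lambda>t. \<gamma> (c * t)) has_vector_derivative c *\<^sub>R v) (at 0)" using chain[of v 0] g(5) by simp
  qed (use g assms(2) in auto)
qed

lemma tangent_frame_in_tangent_space:
  assumes "tangent_frame D d M x b" "i < d"
  shows "b i \<in> tangent_space M x"
proof -
  have "(\<Sum>j<d. (if j = i then 1 else 0) *\<^sub>R b j) = (\<Sum>j<d. if j = i then b i else 0)"
    by (intro sum.cong) auto
  also have "\<dots> = b i" using assms(2) by simp
  finally show ?thesis
    using assms(1) unfolding tangent_frame_def by metis
qed

lemma norm_add_scaled_unit:
  fixes c v :: "'a::real_inner"
  assumes "norm v = 1"
  shows "(norm (c + h *\<^sub>R v))\<^sup>2 = (norm c)\<^sup>2 + 2 * h * (v \<bullet> c) + h\<^sup>2"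
proof -
  have "v \<bullet> v = 1" using assms by (simp add: power2_norm_eq_inner[symmetric])
  then show ?thesis
    unfolding power2_norm_eq_inner inner_add_left inner_add_right inner_scaleR_left inner_scaleR_right
      inner_commute[of c v]
    by (simp add: power2_eq_square distrib_left)
qed

locale framed_reach = reach_bound +
  fixes d :: nat
  assumes d_pos: "0 < d" and frame: "\<And>x. x \<in> M \<Longrightarrow> \<exists>b. tangent_frame D d M x b"
begin

lemma tangent_in_Rn: "v \<in> tangent_space M x \<Longrightarrow> v \<in> Rn D"
  using tangent_space_subset_Rn[OF M_Rn] .

lemma normal_inner_le:
  assumes x: "x \<in> M" and b: "tangent_frame D d M x b"
    and w: "w \<in> Rn D" "\<And>i. i < d \<Longrightarrow> w \<bullet> b i = 0" and y: "y \<in> M"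
  shows "2 * \<tau> * ((y - x) \<bullet> w) \<le> norm w * (norm (y - x))\<^sup>2"
proof (cases "w = 0")
  case False
  let ?n = "w /\<^sub>R norm w"
  obtain K where K: "0 < K" "\<And>n y. n \<in> Rn D \<Longrightarrow> norm n = 1 \<Longrightarrow> (\<forall>i<d. n \<bullet> b i = 0) \<Longrightarrow> y \<in> M \<Longrightarrow>
      (y - x) \<bullet> n \<le> K * (norm (y - x))\<^sup>2"
    using b unfolding tangent_frame_def by blast
  have n: "?n \<in> Rn D" "norm ?n = 1" "\<forall>i<d. ?n \<bullet> b i = 0"
    using w False subspace_scale[OF subspace_Rn] by auto
  have "2 * \<tau> * ((y - x) \<bullet> ?n) \<le> (norm (y - x))\<^sup>2"
    by (rule inner_normal_le[OF x n(1,2) K(1) _ y]) (rule K(2)[OF n])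
  then show ?thesis using False by (simp add: field_simps)
qed simp

text \<open>
Federer's inequality for the normal component of \<open>y - x\<close>. It says that no pair of points makes the
estimator smaller than the reach.
\<close>

lemma infdist_tangent_le:
  assumes "x \<in> M" "y \<in> M"
  shows "infdist (y - x) (tangent_space M x) \<le> (norm (y - x))\<^sup>2 / (2 * \<tau>)"
proof -
  obtain b where b: "tangent_frame D d M x b" using frame[OF assms(1)] by blast
  have on: "\<And>i j. i < d \<Longrightarrow> j < d \<Longrightarrow> b i \<bullet> b j = (if i = j then 1 else 0)"
    using b by (simp add: tangent_frame_def)
  let ?a = "y - x"
  let ?p = "\<Sum>i<d. (?a \<bullet> b i) *\<^sub>R b i"
  define w where "w = ?a - ?p"
  have perp: "w \<bullet> b j = 0" if "j < d" for j
  proof -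
    have "?p \<bullet> b j = (\<Sum>i<d. (?a \<bullet> b i) * (b i \<bullet> b j))" by (simp add: inner_sum_left)
    also have "\<dots> = (\<Sum>i<d. if i = j then ?a \<bullet> b j else 0)"
      using on that by (intro sum.cong) auto
    finally show ?thesis using that by (simp add: w_def inner_diff_left)
  qed
  have "w \<in> Rn D"
    unfolding w_def using assms M_Rn tangent_frame_in_tangent_space[OF b] tangent_in_Rn
    by (intro subspace_diff[OF subspace_Rn] subspace_sum[OF subspace_Rn] subspace_scale[OF subspace_Rn]) auto
  then have "2 * \<tau> * (?a \<bullet> w) \<le> norm w * (norm ?a)\<^sup>2"
    by (intro normal_inner_le[OF assms(1) b _ _ assms(2)]) (simp_all add: perp)
  moreover have "?a \<bullet> w = norm w * norm w"
  proof -
    have "?p \<bullet> w = 0" by (subst inner_commute) (simp add: inner_sum_right perp)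
    moreover have "?a = w + ?p" by (simp add: w_def)
    ultimately have "?a \<bullet> w = w \<bullet> w" by (metis add.right_neutral inner_add_left)
    then show ?thesis by (simp add: power2_norm_eq_inner[symmetric] power2_eq_square)
  qed
  ultimately have "norm w * (2 * \<tau> * norm w) \<le> norm w * (norm ?a)\<^sup>2" by (simp add: algebra_simps)
  then have "2 * \<tau> * norm w \<le> (norm ?a)\<^sup>2"
    by (cases "norm w = 0") (simp_all add: mult_le_cancel_left)
  moreover have "infdist ?a (tangent_space M x) \<le> norm w"
    using b unfolding w_def dist_norm[symmetric] by (intro infdist_le) (simp add: tangent_frame_def)
  then have "2 * \<tau> * infdist ?a (tangent_space M x) \<le> 2 * \<tau> * norm w"
    using tau_pos by (intro mult_left_mono) auto
  ultimately have "2 * \<tau> * infdist ?a (tangent_space M x) \<le> (norm ?a)\<^sup>2" by linarith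
  then show ?thesis using tau_pos by (simp add: pos_le_divide_eq mult.commute)
qed

text \<open>
Moving along a tangent vector, one stays quadratically close to \<open>M\<close>. Let \<open>\<rho> t\<close> be the distance from
\<open>z = q + t v\<close> to \<open>M\<close> and \<open>x\<close> the nearest point. The upper right derivative of
\<open>\<rho>\<^sup>2\<close> is at most \<open>2 (v \<bullet> (z - x))\<close>, and
Federer's inequality at \<open>x\<close>, for the normal \<open>x - z\<close> and the point \<open>q\<close>, bounds it so that \<open>\<rho> t / t\<close>
grows at most at rate \<open>2 / \<tau>\<close>. As \<open>v\<close> is tangent, \<open>\<rho> t / t\<close> starts at \<open>0\<close>. This replaces the usual
arguments with geodesics and the second fundamental form.
\<close>

theorem tangent_ray_near:
  assumes q: "q \<in> M" and v: "v \<in> tangent_space M q" "norm v = 1" and t1: "0 \<le> t1" "t1 < \<tau>"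
  shows "infdist (q + t1 *\<^sub>R v) M \<le> 2 * t1\<^sup>2 / \<tau>"
proof (cases "t1 = 0")
  case False
  then have t1pos: "0 < t1" using t1 by simp
  have vRn: "v \<in> Rn D" using v(1) by (rule tangent_in_Rn)
  define \<rho> where "\<rho> t = infdist (q + t *\<^sub>R v) M" for t
  have rho0: "0 \<le> \<rho> t" for t by (simp add: \<rho>_def infdist_nonneg)
  have bound: "\<rho> t1 \<le> t1 * (\<epsilon> + (2 + \<epsilon>) * t1 / \<tau>)" if eps: "0 < \<epsilon>" for \<epsilon>
  proof -
    \<comment> \<open>\<open>B t / t\<close> grows strictly faster than \<open>\<rho> t / t\<close> can, so \<open>\<rho>\<close> never overtakes \<open>B\<close>; the squares
      are compared because \<open>\<rho>\<close> need not be differentiable where it vanishes.\<close>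
    define B where "B t = t * (\<epsilon> + (2 + \<epsilon>) * t / \<tau>)" for t
    obtain s where s: "0 < s" "\<And>t. 0 < t \<Longrightarrow> t < s \<Longrightarrow> \<rho> t \<le> \<epsilon> * t"
      using infdist_tangent_small[OF v(1) eps] unfolding \<rho>_def by blast
    define a where "a = min (s / 2) t1"
    have a: "0 < a" "a \<le> t1" "a < s" using s t1pos by (auto simp: a_def)
    have B0: "0 < B t" if "0 < t" for t
      unfolding B_def using that eps tau_pos by (intro mult_pos_pos add_pos_nonneg) auto
    have "(\<rho> t1)\<^sup>2 - (B t1)\<^sup>2 \<le> 0"
    proof (rule nonpos_if_no_upcrossing[of a t1 "\<lambda>t. (\<rho> t)\<^sup>2 - (B t)\<^sup>2"])
      show "continuous_on {a..t1} (\<lambda>t. (\<rho> t)\<^sup>2 - (B t)\<^sup>2)"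
        unfolding \<rho>_def B_def using tau_pos by (intro continuous_intros) auto
      have "\<rho> a \<le> \<epsilon> * a" using s(2) a by simp
      also have "\<dots> \<le> B a" unfolding B_def using a eps tau_pos
        by (subst mult.commute) (intro mult_left_mono, auto)
      finally show "(\<rho> a)\<^sup>2 - (B a)\<^sup>2 \<le> 0" using power_mono[of "\<rho> a" "B a" 2] rho0 by simp
      fix t assume t: "a \<le> t" "t < t1" and eq: "(\<rho> t)\<^sup>2 - (B t)\<^sup>2 = 0"
      have tpos: "0 < t" using t a by simp
      have rB: "\<rho> t = B t" using eq rho0[of t] B0[OF tpos] by (simp add: power2_eq_iff)
      define z where "z = q + t *\<^sub>R v"
      define x where "x = foot z"
      have z: "z \<in> Rn D" using ray_add_in_Rn[OF q vRn] by (simp add: z_def)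
      have x: "x \<in> M" "norm (z - x) = \<rho> t"
        using foot[of z] by (auto simp: x_def z_def \<rho>_def dist_norm)
      have "\<rho> t \<le> t" using infdist_le[OF q, of z] tpos v(2) by (simp add: \<rho>_def z_def dist_norm)
      moreover have "norm (q - x) \<le> norm (z - x) + t"
        using norm_triangle_ineq4[of "z - x" "t *\<^sub>R v"] v(2) tpos by (simp add: z_def)
      ultimately have qx: "norm (q - x) \<le> 2 * t" using x by simp
      obtain b where b: "tangent_frame D d M x b" using frame[OF x(1)] by blast
      have perp: "(z - x) \<bullet> u = 0" if "u \<in> tangent_space M x" for u
      proof (rule nearest_point_orthogonal[OF that])
        show "norm (z - x) \<le> norm (z - y)" if "y \<in> M" for y
          using infdist_le[OF that, of z] x(2) by (simp add: \<rho>_def z_def dist_norm)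
      qed
      \<comment> \<open>The normal space at \<open>x\<close> is symmetric, so the ball of radius \<open>\<tau>\<close> on the side of \<open>M\<close>
        opposite to \<open>z\<close> contains no point of \<open>M\<close> either, in particular not \<open>q\<close>.\<close>
      have "2 * \<tau> * ((q - x) \<bullet> - (z - x)) \<le> norm (- (z - x)) * (norm (q - x))\<^sup>2"
      proof (rule normal_inner_le[OF x(1) b _ _ q])
        show "- (z - x) \<in> Rn D"
          using z x M_Rn by (intro subspace_neg[OF subspace_Rn] subspace_diff[OF subspace_Rn]) auto
        show "- (z - x) \<bullet> b i = 0" if "i < d" for i
          unfolding inner_minus_left using perp[OF tangent_frame_in_tangent_space[OF b that]] by (simp only: minus_zero)
      qed
      also have "norm (- (z - x)) * (norm (q - x))\<^sup>2 \<le> \<rho> t * (2 * t)\<^sup>2"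
        unfolding norm_minus_cancel x(2) using qx rho0[of t] by (intro mult_left_mono power_mono) auto
      also have "(q - x) \<bullet> - (z - x) = t * (v \<bullet> (z - x)) - (\<rho> t)\<^sup>2"
      proof -
        have "q - x = (z - x) - t *\<^sub>R v" by (simp add: z_def)
        then have "(q - x) \<bullet> - (z - x) = - ((z - x) \<bullet> (z - x) - t * (v \<bullet> (z - x)))"
          by (simp only: inner_minus_right inner_diff_left[of "z - x" "t *\<^sub>R v"] inner_scaleR_left)
        then show ?thesis by (simp only: x(2)[symmetric] power2_norm_eq_inner minus_diff_eq)
      qed
      finally have key: "t * (v \<bullet> (z - x)) \<le> (\<rho> t)\<^sup>2 + \<rho> t * (2 * t\<^sup>2 / \<tau>)"
        using tau_pos by (simp add: field_simps power2_eq_square)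
      then have key2: "v \<bullet> (z - x) \<le> \<rho> t * (\<rho> t / t + 2 * t / \<tau>)"
        using tpos tau_pos by (simp add: field_simps power2_eq_square)
      have rt: "\<rho> t / t = \<epsilon> + (2 + \<epsilon>) * t / \<tau>" using tpos by (simp add: rB B_def)
      show "\<exists>\<delta>>0. \<forall>h. 0 < h \<and> h < \<delta> \<longrightarrow> (\<rho> (t + h))\<^sup>2 - (B (t + h))\<^sup>2 \<le> 0"
      proof (intro exI[of _ "2 * B t * \<epsilon> * t / \<tau>"] conjI allI impI)
        show "0 < 2 * B t * \<epsilon> * t / \<tau>" using B0[OF tpos] eps tpos tau_pos by simp
        fix h assume h: "0 < h \<and> h < 2 * B t * \<epsilon> * t / \<tau>"
        have "\<rho> (t + h) \<le> norm (z - x + h *\<^sub>R v)"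
          using infdist_le[OF x(1), of "q + (t + h) *\<^sub>R v"]
          by (simp add: \<rho>_def dist_norm z_def algebra_simps)
        then have "(\<rho> (t + h))\<^sup>2 \<le> (norm (z - x + h *\<^sub>R v))\<^sup>2" using rho0 by (intro power_mono)
        also have "\<dots> = (\<rho> t)\<^sup>2 + 2 * h * (v \<bullet> (z - x)) + h\<^sup>2"
          by (simp only: norm_add_scaled_unit[OF v(2)] x(2))
        also have "\<dots> \<le> (\<rho> t)\<^sup>2 + 2 * h * (\<rho> t * (\<rho> t / t + 2 * t / \<tau>)) + h * (2 * B t * \<epsilon> * t / \<tau>)"
        proof (intro add_mono mult_left_mono key2)
          show "h\<^sup>2 \<le> h * (2 * B t * \<epsilon> * t / \<tau>)"
            unfolding power2_eq_square using h by (intro mult_left_mono) linarith+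
        qed (use h in auto)
        also have "\<dots> = (B t)\<^sup>2 + 2 * B t * (h * (\<epsilon> + 2 * (2 + \<epsilon>) * t / \<tau>))"
          unfolding rt unfolding rB using tau_pos by (simp add: field_simps)
        also have "\<dots> \<le> (B t + h * (\<epsilon> + 2 * (2 + \<epsilon>) * t / \<tau>))\<^sup>2"
          by (simp add: power2_sum)
        also have "\<dots> \<le> (B (t + h))\<^sup>2"
        proof (rule power_mono)
          have "B (t + h) = B t + h * (\<epsilon> + 2 * (2 + \<epsilon>) * t / \<tau>) + (2 + \<epsilon>) * h\<^sup>2 / \<tau>"
            unfolding B_def using tau_pos by (simp add: field_simps power2_eq_square)
          moreover have "0 \<le> (2 + \<epsilon>) * h\<^sup>2 / \<tau>" using eps tau_pos by simp
          ultimately show "B t + h * (\<epsilon> + 2 * (2 + \<epsilon>) * t / \<tau>) \<le> B (t + h)" by simp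
          show "0 \<le> B t + h * (\<epsilon> + 2 * (2 + \<epsilon>) * t / \<tau>)"
            using B0[OF tpos] h eps tpos tau_pos by (intro add_nonneg_nonneg mult_nonneg_nonneg) auto
        qed
        finally show "(\<rho> (t + h))\<^sup>2 - (B (t + h))\<^sup>2 \<le> 0" by simp
      qed
    qed (use a in auto)
    then show ?thesis using B0[OF t1pos] power2_le_imp_le[of "\<rho> t1" "B t1"] by (simp add: B_def)
  qed
  have "\<rho> t1 \<le> t1 * (0 + (2 + 0) * t1 / \<tau>)"
  proof (rule tendsto_lowerbound)
    show "((\<lambda>\<epsilon>. t1 * (\<epsilon> + (2 + \<epsilon>) * t1 / \<tau>)) \<longlongrightarrow> t1 * (0 + (2 + 0) * t1 / \<tau>)) (at_right 0)"
      using tau_pos by (intro tendsto_intros) auto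
    show "\<forall>\<^sub>F \<epsilon> in at_right 0. \<rho> t1 \<le> t1 * (\<epsilon> + (2 + \<epsilon>) * t1 / \<tau>)"
      using bound by (auto simp: eventually_at_right_field intro: exI[of _ 1])
  qed simp
  then show ?thesis by (simp add: \<rho>_def power2_eq_square algebra_simps)
qed (use q in \<open>simp add: infdist_zero\<close>)

end

section \<open>The estimator near a bottleneck\<close>

context framed_reach
begin

text \<open>
Variation of the tangent space near \<open>q\<close> in the one direction \<open>n\<close> that matters. Were \<open>v\<close> inclined
towards \<open>n\<close>, a step along \<open>v\<close> would lead into the ball of radius \<open>\<tau>\<close> around \<open>q + \<tau> n\<close>, although it
ends near \<open>M\<close>, which avoids this ball.
\<close>

lemma inner_tangent_near_bottleneck:
  assumes q: "q \<in> M" and n: "n \<in> Rn D" "norm n = 1"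
    and far: "\<And>y. y \<in> M \<Longrightarrow> \<tau> \<le> norm (y - (q + \<tau> *\<^sub>R n))"
    and x: "x \<in> M" "norm (x - q) \<le> r" and r: "0 < r" "r < \<tau>"
    and v: "v \<in> tangent_space M x"
  shows "v \<bullet> n \<le> 11 * r / \<tau> * norm v"
proof (cases "v = 0")
  case False
  have outside: "2 * \<tau> * ((y - q) \<bullet> n) \<le> (norm (y - q))\<^sup>2" if "y \<in> M" for y
  proof -
    have "\<tau>\<^sup>2 \<le> (norm (y - q + (- \<tau>) *\<^sub>R n))\<^sup>2"
      using far[OF that] tau_pos by (intro power_mono) (auto simp: algebra_simps)
    also have "\<dots> = (norm (y - q))\<^sup>2 - 2 * \<tau> * ((y - q) \<bullet> n) + \<tau>\<^sup>2"
      by (subst norm_add_scaled_unit[OF n(2)]) (simp add: inner_commute[of n])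
    finally show ?thesis by simp
  qed
  obtain b where b: "tangent_frame D d M q b" using frame[OF q] by blast
  have perp: "n \<bullet> b i = 0" if "i < d" for i
  proof -
    have "((q + \<tau> *\<^sub>R n) - q) \<bullet> b i = 0"
    proof (rule nearest_point_orthogonal[OF tangent_frame_in_tangent_space[OF b that]])
      show "norm (q + \<tau> *\<^sub>R n - q) \<le> norm (q + \<tau> *\<^sub>R n - y)" if "y \<in> M" for y
        using far[OF that] n tau_pos by (simp add: norm_minus_commute)
    qed
    then show ?thesis using tau_pos by simp
  qed
  \<comment> \<open>The opposite normal ball shows that \<open>x\<close> is at most quadratically below the tangent space at
    \<open>q\<close>.\<close>
  have "2 * \<tau> * ((x - q) \<bullet> - n) \<le> norm (- n) * (norm (x - q))\<^sup>2"
    using n(1) perp x(1) by (intro normal_inner_le[OF q b]) (auto simp: subspace_neg[OF subspace_Rn])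
  also have "\<dots> \<le> r\<^sup>2" using x n by (simp add: power_mono)
  finally have xq: "- (r\<^sup>2 / (2 * \<tau>)) \<le> (x - q) \<bullet> n" using tau_pos by (simp add: field_simps)
  define u where "u = v /\<^sub>R norm v"
  have u: "u \<in> tangent_space M x" "norm u = 1"
    using tangent_space_scale[OF v, of "inverse (norm v)"] False by (simp_all add: u_def)
  \<comment> \<open>A step of length \<open>r\<close> in the direction \<open>u\<close> stays close to \<open>M\<close>, hence outside the ball.\<close>
  define y where "y = foot (x + r *\<^sub>R u)"
  have y: "y \<in> M" "norm (y - (x + r *\<^sub>R u)) \<le> 2 * r\<^sup>2 / \<tau>"
    using foot[of "x + r *\<^sub>R u"] tangent_ray_near[OF x(1) u, of r] r
    by (auto simp: y_def dist_norm norm_minus_commute)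
  have r2: "r\<^sup>2 / \<tau> \<le> r" using r tau_pos by (simp add: field_simps power2_eq_square)
  have decomp: "y - q = (x - q) + r *\<^sub>R u + (y - (x + r *\<^sub>R u))" by simp
  have "norm (y - q) \<le> norm (x - q) + norm (r *\<^sub>R u) + norm (y - (x + r *\<^sub>R u))"
    by (subst decomp) (intro norm_triangle_le add_mono norm_triangle_ineq order_refl)
  then have "norm (y - q) \<le> 4 * r" using x y r u r2 by simp
  then have "(norm (y - q))\<^sup>2 \<le> (4 * r)\<^sup>2" by (intro power_mono) auto
  then have "2 * \<tau> * ((y - q) \<bullet> n) \<le> 16 * r\<^sup>2" using outside[OF y(1)] by (simp add: power_mult_distrib)
  then have yq: "(y - q) \<bullet> n \<le> 8 * r\<^sup>2 / \<tau>" using tau_pos by (simp add: field_simps)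
  have "- (norm (y - (x + r *\<^sub>R u))) \<le> (y - (x + r *\<^sub>R u)) \<bullet> n"
    using Cauchy_Schwarz_ineq2[of "y - (x + r *\<^sub>R u)" n] n by simp
  then have "- (2 * r\<^sup>2 / \<tau>) \<le> (y - (x + r *\<^sub>R u)) \<bullet> n" using y by simp
  moreover have "(y - q) \<bullet> n = (x - q) \<bullet> n + r * (u \<bullet> n) + (y - (x + r *\<^sub>R u)) \<bullet> n"
    by (subst decomp) (simp only: inner_add_left inner_scaleR_left)
  ultimately have "r * (u \<bullet> n) \<le> 8 * r\<^sup>2 / \<tau> + r\<^sup>2 / (2 * \<tau>) + 2 * r\<^sup>2 / \<tau>"
    using xq yq by linarith
  also have "\<dots> \<le> r * (11 * r / \<tau>)" using tau_pos r by (simp add: field_simps power2_eq_square)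
  finally have "u \<bullet> n \<le> 11 * r / \<tau>" unfolding mult_le_cancel_left_pos[OF r(1)] .
  then show ?thesis using False by (simp add: u_def field_simps)
qed simp

text \<open>
For \<open>x = q1\<close> and \<open>y = q2\<close> the vector \<open>y - x = 2 \<tau> n\<close> is normal at \<open>x\<close> and the ratio equals \<open>1 / \<tau>\<close>. Moving the two
points by at most \<open>r\<close> changes the vector by at most \<open>2 r\<close> and lowers its distance to the tangent space by
\<open>O(r)\<close> at most.
\<close>

lemma bottleneck_ratio:
  assumes q1: "q1 \<in> M" and n: "n \<in> Rn D" "norm n = 1" and q2: "q2 = q1 + (2 * \<tau>) *\<^sub>R n"
    and far: "\<And>y. y \<in> M \<Longrightarrow> \<tau> \<le> norm (y - (q1 + \<tau> *\<^sub>R n))"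
    and x: "x \<in> M" "norm (x - q1) \<le> r" and y: "norm (y - q2) \<le> r" and r: "0 < r" "r < \<tau> / 48"
  shows "x \<noteq> y" "0 < infdist (y - x) (tangent_space M x)"
    "1 / \<tau> - 48 * r / \<tau>\<^sup>2 \<le> 2 * infdist (y - x) (tangent_space M x) / (norm (y - x))\<^sup>2"
proof -
  define a where "a = y - x"
  define e where "e = (y - q2) - (x - q1)"
  have a: "a = (2 * \<tau>) *\<^sub>R n + e" by (simp add: a_def e_def q2)
  have e: "norm e \<le> 2 * r" unfolding e_def using norm_triangle_ineq4[of "y - q2" "x - q1"] x y by simp
  have rt: "r < \<tau>" using r tau_pos by simp
  have a_upper: "norm a \<le> 2 * \<tau> + 2 * r"
    using norm_triangle_ineq[of "(2 * \<tau>) *\<^sub>R n" e] n e tau_pos by (simp add: a)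
  have a_lower: "2 * \<tau> - 2 * r \<le> norm a"
    using norm_diff_ineq[of "(2 * \<tau>) *\<^sub>R n" e] n e tau_pos by (simp add: a)
  have anz: "0 < norm a" using a_lower rt by linarith
  then show "x \<noteq> y" by (auto simp: a_def)
  \<comment> \<open>Long tangent vectors are far from \<open>a\<close> anyway; the others satisfy \<open>norm w \<le> 8 \<tau>\<close> and are nearly
    orthogonal to \<open>n\<close>, while \<open>a\<close> is nearly \<open>2 \<tau> n\<close>.\<close>
  have w: "2 * \<tau> - 90 * r \<le> dist a w" if "w \<in> tangent_space M x" for w
  proof (cases "2 * norm a \<le> norm w")
    case True
    have "norm w - norm a \<le> dist a w" using norm_triangle_ineq3[of w a] by (simp add: dist_norm norm_minus_commute)
    then show ?thesis using True a_lower r by linarith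
  next
    case False
    then have "norm w \<le> 8 * \<tau>" using a_upper rt by linarith
    then have "11 * r / \<tau> * norm w \<le> 11 * r / \<tau> * (8 * \<tau>)"
      using r tau_pos by (intro mult_left_mono) auto
    then have "w \<bullet> n \<le> 88 * r"
      using inner_tangent_near_bottleneck[OF q1 n far x r(1) rt that] tau_pos by simp
    moreover have "2 * \<tau> - 2 * r \<le> a \<bullet> n"
    proof -
      have "n \<bullet> n = 1" using n(2) by (simp add: power2_norm_eq_inner[symmetric])
      moreover have "- norm e \<le> e \<bullet> n" using Cauchy_Schwarz_ineq2[of e n] n by simp
      ultimately show ?thesis using e by (simp add: a inner_add_left)
    qed
    moreover have "(a - w) \<bullet> n \<le> dist a w" 
      using norm_cauchy_schwarz[of "a - w" n] n by (simp add: dist_norm)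
    ultimately show ?thesis by (simp add: inner_diff_left)
  qed
  have ne: "tangent_space M x \<noteq> {}"
    using frame[OF x(1)] unfolding tangent_frame_def by blast
  have D: "2 * \<tau> - 90 * r \<le> infdist a (tangent_space M x)"
    unfolding infdist_def using ne w by (auto intro!: cINF_greatest)
  then show "0 < infdist (y - x) (tangent_space M x)" using r by (simp add: a_def)
  have "1 / \<tau> - 48 * r / \<tau>\<^sup>2 \<le> 2 * (2 * \<tau> - 90 * r) / (2 * \<tau> + 2 * r)\<^sup>2"
  proof -
    \<comment> \<open>\<open>45\<close> is half of \<open>90\<close>, and \<open>(\<tau> + r)\<^sup>2 \<le> \<tau>\<^sup>2 + 3 \<tau> r\<close> accounts for the other \<open>3\<close>.\<close>
    have "(\<tau> - 48 * r) * (\<tau> + r)\<^sup>2 \<le> (\<tau> - 45 * r) * \<tau>\<^sup>2"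
    proof -
      have "(\<tau> - 45 * r) * \<tau>\<^sup>2 - (\<tau> - 48 * r) * (\<tau> + r)\<^sup>2 = \<tau> * r * (\<tau> - r) + 96 * \<tau> * r\<^sup>2 + 48 * r ^ 3"
        by (simp add: algebra_simps power2_eq_square power3_eq_cube)
      also have "\<dots> \<ge> 0" using r rt tau_pos by (intro add_nonneg_nonneg mult_nonneg_nonneg) auto
      finally show ?thesis by simp
    qed
    then have "(\<tau> - 48 * r) / \<tau>\<^sup>2 \<le> (\<tau> - 45 * r) / (\<tau> + r)\<^sup>2"
      using tau_pos r by (simp add: divide_simps mult.commute)
    moreover have "1 / \<tau> - 48 * r / \<tau>\<^sup>2 = (\<tau> - 48 * r) / \<tau>\<^sup>2"
      using tau_pos by (simp add: field_simps power2_eq_square)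
    moreover have "2 * (2 * \<tau> - 90 * r) / (2 * \<tau> + 2 * r)\<^sup>2 = (\<tau> - 45 * r) / (\<tau> + r)\<^sup>2"
    proof -
      have "(2 * \<tau> + 2 * r)\<^sup>2 = 4 * (\<tau> + r)\<^sup>2" by (simp add: power2_eq_square algebra_simps)
      moreover have "2 * (2 * \<tau> - 90 * r) = 4 * (\<tau> - 45 * r)" by simp
      ultimately show ?thesis by (simp only:)
    qed
    ultimately show ?thesis by simp
  qed
  also have "\<dots> \<le> 2 * (2 * \<tau> - 90 * r) / (norm a)\<^sup>2"
    using a_upper anz r by (intro divide_left_mono power_mono) auto
  also have "\<dots> \<le> 2 * infdist a (tangent_space M x) / (norm a)\<^sup>2"
    using D by (intro divide_right_mono mult_left_mono) auto
  finally show "1 / \<tau> - 48 * r / \<tau>\<^sup>2 \<le> 2 * infdist (y - x) (tangent_space M x) / (norm (y - x))\<^sup>2"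
    by (simp add: a_def)
qed

lemma tau_hat_ge:
  assumes "X \<subseteq> M"
  shows "ereal \<tau> \<le> tau_hat M X"
  unfolding tau_hat_def
proof (rule INF_greatest, clarify)
  fix x y assume xy: "x \<in> X" "y \<in> X" "x \<noteq> y"
  let ?d = "infdist (y - x) (tangent_space M x)"
  have d: "?d \<le> (norm (y - x))\<^sup>2 / (2 * \<tau>)" using infdist_tangent_le xy assms by blast
  show "ereal \<tau> \<le> ereal ((norm (y - x))\<^sup>2) / ereal (2 * ?d)"
  proof (cases "?d = 0")
    case True
    moreover have "ereal ((norm (y - x))\<^sup>2) / 0 = \<infinity>" using xy by (simp add: divide_ereal_def)
    ultimately show ?thesis by (simp add: zero_ereal_def[symmetric])
  next
    case False
    then have "0 < ?d" using infdist_nonneg[of "y - x" "tangent_space M x"] by linarith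
    then show ?thesis using d tau_pos by (simp add: field_simps)
  qed
qed

lemma inverse_tau_hat:
  assumes "X \<subseteq> M"
  obtains u where "1 / tau_hat M X = ereal u" "0 \<le> u" "u \<le> 1 / \<tau>"
proof (cases "tau_hat M X")
  case (real h)
  then have "\<tau> \<le> h" using tau_hat_ge[OF assms] by simp
  then show thesis using real tau_pos by (intro that[of "1 / h"]) (auto simp: field_simps one_ereal_def)
next
  case PInf
  then show thesis using tau_pos by (intro that[of 0]) (auto simp: zero_ereal_def)
qed (use tau_hat_ge[OF assms] in auto)

lemma loss_le_trivial:
  assumes "X \<subseteq> M" "0 \<le> p"
  shows "abs_powr (1 / ereal \<tau> - 1 / tau_hat M X) p \<le> ennreal ((1 / \<tau>) powr p)"
proof -
  obtain u where u: "1 / tau_hat M X = ereal u" "0 \<le> u" "u \<le> 1 / \<tau>" by (rule inverse_tau_hat[OF assms(1)])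
  have "1 / ereal \<tau> - 1 / tau_hat M X = ereal (1 / \<tau> - u)" using tau_pos u by (simp add: one_ereal_def)
  then show ?thesis using u assms by (auto simp: abs_powr_def intro!: ennreal_leI powr_mono2)
qed

lemma loss_le_near_bottleneck:
  assumes X: "X \<subseteq> M" and p: "0 \<le> p"
    and q1: "q1 \<in> M" and n: "n \<in> Rn D" "norm n = 1" and q2: "q2 = q1 + (2 * \<tau>) *\<^sub>R n"
    and far: "\<And>y. y \<in> M \<Longrightarrow> \<tau> \<le> norm (y - (q1 + \<tau> *\<^sub>R n))"
    and x: "x \<in> X" "norm (x - q1) \<le> r" and y: "y \<in> X" "norm (y - q2) \<le> r" and r: "0 < r"
  shows "abs_powr (1 / ereal \<tau> - 1 / tau_hat M X) p \<le> ennreal ((48 * r / \<tau>\<^sup>2) powr p)"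
proof (cases "r < \<tau> / 48")
  case False
  then have "1 / \<tau> \<le> 48 * r / \<tau>\<^sup>2" using tau_pos by (simp add: field_simps power2_eq_square)
  then have "ennreal ((1 / \<tau>) powr p) \<le> ennreal ((48 * r / \<tau>\<^sup>2) powr p)"
    using tau_pos p by (intro ennreal_leI powr_mono2) auto
  then show ?thesis by (rule order_trans[OF loss_le_trivial[OF X p]])
next
  case True
  obtain u where u: "1 / tau_hat M X = ereal u" "0 \<le> u" "u \<le> 1 / \<tau>" by (rule inverse_tau_hat[OF X])
  let ?d = "infdist (y - x) (tangent_space M x)"
  have xM: "x \<in> M" using x X by auto
  note R = bottleneck_ratio[OF q1 n q2 far xM x(2) y(2) r True]
  have "tau_hat M X \<le> ereal ((norm (y - x))\<^sup>2) / ereal (2 * ?d)"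
    unfolding tau_hat_def by (rule INF_lower2[of "(x, y)"]) (use x y R in auto)
  then have h: "tau_hat M X \<le> ereal ((norm (y - x))\<^sup>2 / (2 * ?d))" using R(2) by simp
  then obtain h where h': "tau_hat M X = ereal h" "\<tau> \<le> h"
    using tau_hat_ge[OF X] by (cases "tau_hat M X") auto
  have "2 * ?d / (norm (y - x))\<^sup>2 \<le> 1 / h"
    using h h' R(1,2) tau_pos by (simp add: field_simps)
  also have "1 / h = u" using u h' tau_pos by (simp add: one_ereal_def)
  finally have "1 / \<tau> - u \<le> 48 * r / \<tau>\<^sup>2" using R(3) by simp
  moreover have "1 / ereal \<tau> - 1 / tau_hat M X = ereal (1 / \<tau> - u)" using tau_pos u by (simp add: one_ereal_def)
  ultimately show ?thesis using u p by (auto simp: abs_powr_def intro!: ennreal_leI powr_mono2)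
qed

end

section \<open>Hausdorff measure of balls\<close>

lemma norm_orthonormal_sum:
  assumes on: "\<And>i j. i < d \<Longrightarrow> j < d \<Longrightarrow> b i \<bullet> b j = (if i = j then 1 else 0)"
  shows "norm (\<Sum>i<(d::nat). c i *\<^sub>R (b i :: fseq)) = norm (vec_of d c)"
proof -
  have "(\<Sum>i<d. c i *\<^sub>R b i) \<bullet> (\<Sum>j<d. c j *\<^sub>R b j) = (\<Sum>i<d. (c i)\<^sup>2)"
  proof -
    have "(\<Sum>i<d. c i *\<^sub>R b i) \<bullet> (\<Sum>j<d. c j *\<^sub>R b j) = (\<Sum>i<d. \<Sum>j<d. c i * (c j * (b i \<bullet> b j)))"
      unfolding inner_sum_left unfolding inner_sum_right by (simp add: mult.left_commute)
    also have "\<dots> = (\<Sum>i<d. \<Sum>j<d. if j = i then (c i)\<^sup>2 else 0)"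
      by (intro sum.cong) (auto simp: on power2_eq_square)
    finally show ?thesis by simp
  qed
  then show ?thesis
    by (subst norm_Rn[of "vec_of d c" d]) (simp_all add: norm_eq_sqrt_inner coord_vec_of)
qed

lemma bessel:
  assumes on: "\<And>i j. i < d \<Longrightarrow> j < d \<Longrightarrow> b i \<bullet> b j = (if i = j then 1 else 0)"
  shows "norm (vec_of d (\<lambda>i. z \<bullet> (b i :: fseq))) \<le> norm z"
proof -
  let ?p = "\<Sum>i<d. (z \<bullet> b i) *\<^sub>R b i"
  let ?v = "vec_of d (\<lambda>i. z \<bullet> b i)"
  have np: "norm ?p = norm ?v" by (rule norm_orthonormal_sum[OF on])
  have "(norm ?v)\<^sup>2 = (\<Sum>i<d. (z \<bullet> b i)\<^sup>2)"
    by (subst norm_Rn[of ?v d]) (simp_all add: coord_vec_of sum_nonneg)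
  also have "\<dots> = z \<bullet> ?p" by (simp add: inner_sum_right power2_eq_square)
  also have "\<dots> \<le> norm z * norm ?v" unfolding np[symmetric] by (rule norm_cauchy_schwarz)
  finally show ?thesis by (cases "norm ?v = 0") (simp_all add: power2_eq_square)
qed

context framed_reach
begin

text \<open>
The orthogonal projection of \<open>M\<close> near \<open>q\<close> onto the tangent space covers a ball. Send a tangent vector
\<open>u\<close> to the projection of the point of \<open>M\<close> nearest to \<open>q + u\<close>: this map is continuous, and as
\<open>q + u\<close> is close to \<open>M\<close>, it moves points by at most \<open>t / 4\<close>, so Brouwer's theorem applies.
\<close>

lemma tangent_projection_covers:
  assumes q: "q \<in> M" and b: "tangent_frame D d M q b" and t: "0 < t" "t \<le> \<tau> / 8"
    and w: "w \<in> Rn d" "norm w \<le> t / 2"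
  obtains y where "y \<in> M" "norm (y - q) \<le> 2 * t" "\<And>i. i < d \<Longrightarrow> (y - q) \<bullet> b i = coord w i"
proof -
  have on: "\<And>i j. i < d \<Longrightarrow> j < d \<Longrightarrow> b i \<bullet> b j = (if i = j then 1 else 0)"
    and tan: "\<And>c. (\<Sum>i<d. c i *\<^sub>R b i) \<in> tangent_space M q"
    using b by (simp_all add: tangent_frame_def)
  define L where "L u = (\<Sum>i<d. coord u i *\<^sub>R b i)" for u
  have normL: "norm (L u) = norm u" if "u \<in> Rn d" for u
    using norm_orthonormal_sum[OF on, where c = "coord u"] vec_of_coord[OF that] by (simp add: L_def)
  have LRn: "L u \<in> Rn D" for u unfolding L_def using tan tangent_in_Rn by blast
  then have PRn: "q + L u \<in> Rn D" for u using q M_Rn subspace_add[OF subspace_Rn] by blast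
  have near: "norm (foot (q + L u) - (q + L u)) \<le> t / 4" if u: "u \<in> Rn d" "norm u \<le> t" for u
  proof (cases "u = 0")
    case True
    then have "L u = 0" by (simp add: L_def)
    then show ?thesis using foot(2)[of q] q t by (simp add: dist_norm norm_minus_commute)
  next
    case False
    define v where "v = L u /\<^sub>R norm u"
    have v: "v \<in> tangent_space M q" "norm v = 1"
      using tangent_space_scale[OF tan, of "inverse (norm u)" "coord u"] False normL[OF u(1)]
      by (simp_all add: v_def L_def)
    have "L u = norm u *\<^sub>R v" using False by (simp add: v_def)
    then have "infdist (q + L u) M \<le> 2 * (norm u)\<^sup>2 / \<tau>"
      using tangent_ray_near[OF q v, of "norm u"] u t tau_pos by simp
    also have "\<dots> \<le> 2 * (t * (\<tau> / 8)) / \<tau>"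
      using u t tau_pos unfolding power2_eq_square by (intro divide_right_mono mult_left_mono mult_mono) auto
    also have "\<dots> = t / 4" using tau_pos by simp
    finally show ?thesis using foot(2)[of "q + L u"] by (simp add: dist_norm norm_minus_commute)
  qed
  define F where "F u = vec_of d (\<lambda>i. (foot (q + L u) - q) \<bullet> b i)" for u
  have "w \<in> F ` (Rn d \<inter> cball 0 t)"
  proof (rule near_identity_covers[where \<epsilon> = "t / 4"])
    have contL: "continuous_on S (\<lambda>u. q + L u)" for S
      unfolding L_def by (intro continuous_intros)
    have "continuous_on (Rn d \<inter> cball 0 t) (\<lambda>u. foot (q + L u))"
    proof (rule continuous_on_compose2[OF continuous_on_foot contL])
      show "(\<lambda>u. q + L u) ` (Rn d \<inter> cball 0 t) \<subseteq> {z \<in> Rn D. infdist z M < \<tau>}"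
      proof clarify
        fix u assume u: "u \<in> Rn d" "u \<in> cball 0 t"
        have "infdist (q + L u) M \<le> norm u"
          using infdist_le[OF q, of "q + L u"] normL[OF u(1)] by (simp add: dist_norm)
        then show "q + L u \<in> Rn D \<and> infdist (q + L u) M < \<tau>" using PRn u t tau_pos by simp
      qed
    qed
    then show "continuous_on (Rn d \<inter> cball 0 t) F"
      unfolding F_def vec_of_def by (intro continuous_intros)
    show "norm (F u - u) \<le> t / 4" if u: "u \<in> Rn d" "norm u \<le> t" for u
    proof -
      have "F u - u = vec_of d (\<lambda>i. (foot (q + L u) - (q + L u)) \<bullet> b i)"
      proof (rule fseq_eqI)
        fix i
        have "L u \<bullet> b i = coord u i" if "i < d"
        proof -
          have "L u \<bullet> b i = (\<Sum>j<d. coord u j * (b j \<bullet> b i))" by (simp add: L_def inner_sum_left)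
          also have "\<dots> = (\<Sum>j<d. if j = i then coord u i else 0)"
            using that by (intro sum.cong) (auto simp: on)
          finally show ?thesis using that by simp
        qed
        then show "coord (F u - u) i = coord (vec_of d (\<lambda>i. (foot (q + L u) - (q + L u)) \<bullet> b i)) i"
          using u(1) by (auto simp: F_def coord_vec_of inner_diff_left inner_add_left Rn_def)
      qed
      then have "norm (F u - u) \<le> norm (foot (q + L u) - (q + L u))"
        using bessel[OF on] by simp
      then show ?thesis using near[OF u] by linarith
    qed
  qed (use d_pos t w in \<open>auto simp: F_def\<close>)
  then obtain u where u: "u \<in> Rn d" "norm u \<le> t" "w = F u" by auto
  show thesis
  proof (rule that[of "foot (q + L u)"])
    have "norm (foot (q + L u) - q) \<le> norm (foot (q + L u) - (q + L u)) + norm (L u)"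
      using norm_triangle_ineq[of "foot (q + L u) - (q + L u)" "L u"] by simp
    then show "norm (foot (q + L u) - q) \<le> 2 * t" using near[OF u(1,2)] normL[OF u(1)] u(2) t by linarith
    show "(foot (q + L u) - q) \<bullet> b i = coord w i" if "i < d" for i
      using that by (simp add: u(3) F_def coord_vec_of)
  qed (rule foot(1))
qed

end

text \<open>
A set of diameter \<open>a\<close> is mapped by \<open>G\<close> into a box of side \<open>2 a\<close>; comparing Lebesgue measures in
\<open>\<real>\<^sup>d\<close>, realised as a product measure because \<open>d\<close> is a number, bounds the sum over any cover.
\<close>

lemma hausdorff_pre_ge_cube:
  fixes A :: "'a::metric_space set" and G :: "'a \<Rightarrow> nat \<Rightarrow> real"
  assumes d: "0 < d" and s: "0 \<le> s"
    and lip: "\<And>i x y. i < d \<Longrightarrow> \<bar>G x i - G y i\<bar> \<le> dist x y"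
    and covers: "\<And>w. (\<And>i. i < d \<Longrightarrow> \<bar>w i\<bar> \<le> s) \<Longrightarrow> \<exists>y\<in>A. \<forall>i<d. G y i = w i"
  shows "ennreal (unit_ball_vol (real d) * (s / 2) ^ d) \<le> hausdorff_pre d \<delta> A"
  unfolding hausdorff_pre_def
proof (rule INF_greatest, clarify)
  fix U :: "nat \<Rightarrow> 'a set"
  assume cover: "A \<subseteq> (\<Union>i. U i)" and U: "\<forall>i. bounded (U i) \<and> diameter (U i) \<le> \<delta>"
  interpret product_sigma_finite "\<lambda>i::nat. lborel :: real measure" ..
  let ?N = "\<Pi>\<^sub>M i\<in>{..<d}. (lborel :: real measure)"
  let ?C = "\<Pi>\<^sub>E i\<in>{..<d}. {-s..s}"
  define y where "y k = (SOME x. x \<in> U k)" for k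
  \<comment> \<open>For empty \<open>U k\<close>, the box around the arbitrary point \<open>y k\<close> has measure \<open>0\<close>, as \<open>0 < d\<close>.\<close>
  define B where "B k = (\<Pi>\<^sub>E i\<in>{..<d}. {G (y k) i - diameter (U k)..G (y k) i + diameter (U k)})" for k
  have diam0: "0 \<le> diameter (U k)" for k using U by (simp add: diameter_ge_0)
  have "?C \<subseteq> (\<Union>k. B k)"
  proof
    fix w assume w: "w \<in> ?C"
    have "\<bar>w i\<bar> \<le> s" if "i < d" for i
    proof -
      have "w i \<in> {-s..s}" using w that by (auto simp: PiE_iff)
      then show ?thesis by auto
    qed
    then obtain x where x: "x \<in> A" "\<forall>i<d. G x i = w i" using covers by blast
    then obtain k where k: "x \<in> U k" using cover by auto
    then have "y k \<in> U k" unfolding y_def by (rule someI)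
    then have "dist x (y k) \<le> diameter (U k)" using U k by (intro diameter_bounded_bound) auto
    then have "\<bar>w i - G (y k) i\<bar> \<le> diameter (U k)" if "i < d" for i
      using lip[OF that, of x "y k"] x that by auto
    then have "w \<in> B k" using w by (auto simp: B_def PiE_iff abs_le_iff algebra_simps)
    then show "w \<in> (\<Union>k. B k)" by blast
  qed
  moreover have B: "B k \<in> sets ?N" for k unfolding B_def by (intro sets_PiM_I_finite) auto
  ultimately have "emeasure ?N ?C \<le> emeasure ?N (\<Union>k. B k)" by (intro emeasure_mono sets.countable_UN) auto
  also have "\<dots> \<le> (suminf (\<lambda>k. emeasure ?N (B k)))" by (rule emeasure_subadditive_countably) (use B in auto)
  also have "emeasure ?N ?C = ennreal ((2 * s) ^ d)"
    using s by (subst emeasure_PiM) (auto simp: ennreal_power)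
  also have "(\<lambda>k. emeasure ?N (B k)) = (\<lambda>k. ennreal ((2 * diameter (U k)) ^ d))"
    unfolding B_def using diam0 by (subst emeasure_PiM) (auto simp: ennreal_power)
  finally have main: "ennreal ((2 * s) ^ d) \<le> (suminf (\<lambda>k. ennreal ((2 * diameter (U k)) ^ d)))" .
  let ?c = "unit_ball_vol (real d) / 4 ^ d"
  have c: "0 \<le> ?c" by simp
  have eq: "unit_ball_vol (real d) * (a / 2) ^ d = ?c * (2 * a) ^ d" for a
  proof -
    have "(a / 2) ^ d = (2 * a) ^ d / 4 ^ d"
      by (subst power_divide[symmetric]) simp
    then show ?thesis by simp
  qed
  have "ennreal (unit_ball_vol (real d) * (s / 2) ^ d) = ennreal ?c * ennreal ((2 * s) ^ d)"
    unfolding eq using s by (intro ennreal_mult) auto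
  also have "\<dots> \<le> ennreal ?c * (suminf (\<lambda>k. ennreal ((2 * diameter (U k)) ^ d)))"
    using main by (rule mult_left_mono) simp
  also have "\<dots> = (suminf (\<lambda>k. ennreal ?c * ennreal ((2 * diameter (U k)) ^ d)))" by (rule ennreal_suminf_cmult[symmetric])
  also have "\<dots> = (suminf (\<lambda>k. ennreal (unit_ball_vol (real d) * (diameter (U k) / 2) ^ d)))"
    unfolding eq using diam0 by (intro suminf_cong ennreal_mult[symmetric]) auto
  finally show "ennreal (unit_ball_vol (real d) * (s / 2) ^ d)
    \<le> (suminf (\<lambda>i. ennreal (unit_ball_vol (real d) * (diameter (U i) / 2) ^ d)))" .
qed

context framed_reach
begin

lemma hausdorff_pre_ball_ge:
  assumes q: "q \<in> M" and r: "0 < r" "r \<le> \<tau> / 2"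
  shows "ennreal (unit_ball_vol (real d) * (r / (16 * real d)) ^ d) \<le> hausdorff_pre d \<delta> (M \<inter> ball q r)"
proof -
  obtain b where b: "tangent_frame D d M q b" using frame[OF q] by blast
  have nb: "norm (b i) = 1" if "i < d" for i
    using b that by (simp add: tangent_frame_def norm_eq_sqrt_inner)
  define s where "s = r / (8 * real d)"
  have "ennreal (unit_ball_vol (real d) * (s / 2) ^ d) \<le> hausdorff_pre d \<delta> (M \<inter> ball q r)"
  proof (rule hausdorff_pre_ge_cube[OF d_pos, where G = "\<lambda>y i. (y - q) \<bullet> b i"])
    show "0 \<le> s" using r by (simp add: s_def)
    show "\<bar>(x - q) \<bullet> b i - (y - q) \<bullet> b i\<bar> \<le> dist x y" if "i < d" for i x y
      using Cauchy_Schwarz_ineq2[of "x - y" "b i"] nb[OF that]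
      by (simp add: inner_diff_left[symmetric] dist_norm)
    fix w :: "nat \<Rightarrow> real" assume w: "\<And>i. i < d \<Longrightarrow> \<bar>w i\<bar> \<le> s"
    have "norm (vec_of d w) \<le> (\<Sum>i<d. \<bar>coord (vec_of d w) i\<bar>)"
      by (subst norm_Rn[of _ d]) (auto intro: sqrt_sum_squares_le_sum_abs L2_set_le_sum_abs[unfolded L2_set_def])
    also have "\<dots> \<le> (\<Sum>i<d. s)" using w by (intro sum_mono) (simp add: coord_vec_of)
    also have "\<dots> = r / 8" using d_pos by (simp add: s_def)
    finally obtain y where "y \<in> M" "norm (y - q) \<le> 2 * (r / 4)" "\<And>i. i < d \<Longrightarrow> (y - q) \<bullet> b i = w i"
      using tangent_projection_covers[OF q b, of "r / 4" "vec_of d w"] r by (auto simp: coord_vec_of)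
    then show "\<exists>y\<in>M \<inter> ball q r. \<forall>i<d. (y - q) \<bullet> b i = w i"
      using r by (intro bexI[of _ y]) (auto simp: dist_norm norm_minus_commute)
  qed
  then show ?thesis by (simp add: s_def)
qed

end

section \<open>Mass of balls\<close>

lemma sets_hausdorff_measure: "sets (hausdorff_measure d) = sets borel"
  unfolding hausdorff_measure_def by (simp add: sets_measure_of_conv sets.sigma_sets_eq[of borel, simplified])

lemma space_hausdorff_measure: "space (hausdorff_measure d) = UNIV"
  using sets_eq_imp_space_eq[OF sets_hausdorff_measure] by simp

text \<open>
Countable additivity of the outer measure is obtained from the existence of a set of nonzero measure, since
\<open>measure_of\<close> yields the zero measure when additivity fails.
\<close>

lemma hausdorff_measure_ge:
  fixes X A :: "'a::metric_space set"
  assumes "emeasure (hausdorff_measure d) X \<noteq> 0" and "A \<in> sets borel" and "c \<le> hausdorff_pre d 1 A"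
  shows "c \<le> emeasure (hausdorff_measure d) A"
proof -
  let ?\<mu> = "\<lambda>A::'a set. SUP \<delta>\<in>{0<..}. hausdorff_pre d \<delta> A"
  have conv: "emeasure (hausdorff_measure d) B =
      (if B \<in> sigma_sets UNIV (sets borel) \<and> measure_space UNIV (sigma_sets UNIV (sets borel)) ?\<mu> then ?\<mu> B else 0)" for B :: "'a set"
    unfolding hausdorff_measure_def by (simp only: emeasure_measure_of_conv)
  have "measure_space UNIV (sigma_sets UNIV (sets borel)) ?\<mu>"
    using assms(1) by (auto simp: conv split: if_splits)
  moreover have "A \<in> sigma_sets UNIV (sets borel)" using assms(2) by auto
  ultimately have "emeasure (hausdorff_measure d) A = ?\<mu> A" by (simp add: conv)
  also have "\<dots> \<ge> hausdorff_pre d 1 A" by (rule SUP_upper) simp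
  finally show ?thesis using assms(3) by (rule order_trans[rotated])
qed

text \<open>
For measurable \<open>g\<close> this is an equality; otherwise \<open>distr\<close> may assign the value \<open>0\<close>. In this form it
applies to the map \<open>x \<mapsto> (x, T\<^sub>x M)\<close> that defines the law of a sample point with its tangent space.
\<close>

lemma emeasure_distr_le: "emeasure (distr N K g) Z \<le> emeasure N (g -` Z \<inter> space N)"
  unfolding distr_def by (subst emeasure_measure_of_conv) simp

definition ball_constant :: "nat \<Rightarrow> real" where
  "ball_constant d = unit_ball_vol (real d) / (16 * real d) ^ d"

lemma ball_constant_pos: "1 \<le> d \<Longrightarrow> 0 < ball_constant d"
  by (simp add: ball_constant_def)

context framed_reach
begin

lemma M_borel: "M \<in> sets borel"
  using compact_M by (simp add: compact_imp_closed)

lemma density_ball_ge: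
  assumes Q: "prob_space Q"
    and dens: "Q = density (restrict_space (hausdorff_measure d) (Rn D)) (\<lambda>x. ennreal (f x) * indicator M x)"
    and f: "f \<in> borel_measurable (restrict_space borel M)" "\<forall>x\<in>M. fmin \<le> f x" and fmin: "0 < fmin"
    and q: "q \<in> M" and r: "0 < r" "r \<le> \<tau> / 2"
  shows "ennreal (fmin * (ball_constant d * r ^ d)) \<le> emeasure Q (M \<inter> ball q r)"
proof -
  let ?H = "restrict_space (hausdorff_measure d) (Rn D)"
  let ?g = "\<lambda>x. ennreal (f x) * indicator M x"
  let ?B = "M \<inter> ball q r"
  have setsH: "sets ?H = sets (restrict_space borel (Rn D))"
    by (simp add: sets_restrict_space sets_hausdorff_measure)
  have spH: "space ?H = Rn D" by (simp add: space_restrict_space space_hausdorff_measure)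
  have "(\<lambda>x. ennreal (f x)) \<in> borel_measurable (restrict_space borel M)"
    using f(1) by measurable
  then have "?g \<in> borel_measurable borel"
    using borel_measurable_restrict_space_iff_ennreal[of M borel "\<lambda>x. ennreal (f x)"] M_borel by simp
  then have g: "?g \<in> borel_measurable ?H"
    by (subst measurable_cong_sets[OF setsH refl]) (rule measurable_restrict_space1)
  have "?B \<in> sets borel" using M_borel by simp
  moreover have BR: "?B \<subseteq> Rn D" using M_Rn by auto
  ultimately have B: "?B \<in> sets ?H"
    unfolding setsH sets_restrict_space by (auto simp: sets_hausdorff_measure intro!: image_eqI[of _ _ ?B])
  have Rn_sets: "Rn D \<inter> space (hausdorff_measure d) \<in> sets (hausdorff_measure d)"
    by (simp add: space_hausdorff_measure sets_hausdorff_measure closed_Rn)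
  \<comment> \<open>Otherwise \<open>Q\<close> would be the zero measure.\<close>
  have "emeasure (hausdorff_measure d) (Rn D) \<noteq> 0"
  proof
    assume 0: "emeasure (hausdorff_measure d) (Rn D) = 0"
    then have "emeasure ?H (Rn D) = 0" by (subst emeasure_restrict_space[OF Rn_sets]) auto
    then have "Rn D \<in> null_sets ?H" using sets.top[of ?H] spH by (auto simp: null_sets_def)
    then have "AE x in ?H. ?g x = 0" using AE_not_in[of "Rn D" ?H] spH by (auto intro: AE_mp)
    then have "(\<integral>\<^sup>+x. ?g x * indicator (space ?H) x \<partial>?H) = 0"
      using g by (subst nn_integral_0_iff_AE) auto
    then have "emeasure Q (space Q) = 0"
      unfolding dens using g by (subst emeasure_density) auto
    then show False using prob_space.emeasure_space_1[OF Q] by simp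
  qed
  then have "ennreal (unit_ball_vol (real d) * (r / (16 * real d)) ^ d) \<le> emeasure (hausdorff_measure d) ?B"
    by (rule hausdorff_measure_ge) (use \<open>?B \<in> sets borel\<close> hausdorff_pre_ball_ge[OF q r] in auto)
  moreover have "unit_ball_vol (real d) * (r / (16 * real d)) ^ d = ball_constant d * r ^ d"
    by (simp add: ball_constant_def power_divide)
  moreover have "emeasure ?H ?B = emeasure (hausdorff_measure d) ?B"
    by (rule emeasure_restrict_space[OF Rn_sets BR])
  ultimately have ge: "ennreal (ball_constant d * r ^ d) \<le> emeasure ?H ?B" by simp
  have "ennreal (fmin * (ball_constant d * r ^ d)) = ennreal fmin * ennreal (ball_constant d * r ^ d)"
    using fmin r by (intro ennreal_mult) (auto simp: ball_constant_def)
  also have "\<dots> \<le> ennreal fmin * emeasure ?H ?B" using ge by (intro mult_left_mono) auto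
  also have "\<dots> = (\<integral>\<^sup>+x. ennreal fmin * indicator ?B x \<partial>?H)" using B by (simp add: nn_integral_cmult_indicator)
  also have "\<dots> \<le> (\<integral>\<^sup>+x. ?g x * indicator ?B x \<partial>?H)"
    using f(2) by (intro nn_integral_mono) (auto split: split_indicator intro: ennreal_leI)
  also have "\<dots> = emeasure Q ?B" unfolding dens using g B by (simp add: emeasure_density)
  finally show ?thesis .
qed

end

section \<open>The constant\<close>

lemma summable_powr_exp:
  assumes "0 < (c::real)"
  shows "summable (\<lambda>k. (real k + 1) powr p * exp (- (c * real k)))"
proof (rule summable_comparison_test_bigo)
  show "summable (\<lambda>k. norm (1 / real k ^ 2))"
    using inverse_power_summable[of 2, where 'a = real] by (simp add: divide_inverse)
  show "(\<lambda>k. (real k + 1) powr p * exp (- (c * real k))) \<in> O(\<lambda>k. 1 / real k ^ 2)"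
    using assms by real_asymp
qed

definition bottleneck_series :: "real \<Rightarrow> nat \<Rightarrow> real \<Rightarrow> real" where
  "bottleneck_series fmin d p =
     suminf (\<lambda>k. 2 * ((real k + 1) powr p * exp (- (fmin * ball_constant d * real k))))"

text \<open>
The first factor and the factors \<open>(k + 1)\<^sup>p\<close> of the series come from the error \<open>48 r / \<tau>\<^sup>2\<close> at radius
\<open>r = (k + 1) n\<^sup>-\<^sup>1\<^sup>/\<^sup>d\<close>; the exponentials bound the probability that one of two balls of radius
\<open>k n\<^sup>-\<^sup>1\<^sup>/\<^sup>d\<close> contains no sample point.
\<close>

definition bottleneck_constant :: "real \<Rightarrow> real \<Rightarrow> nat \<Rightarrow> real \<Rightarrow> real" where
  "bottleneck_constant \<tau> fmin d p = (48 / \<tau>\<^sup>2) powr p * bottleneck_series fmin d p"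

lemma summable_bottleneck_series:
  assumes "0 < fmin" "1 \<le> d"
  shows "summable (\<lambda>k. 2 * ((real k + 1) powr p * exp (- (fmin * ball_constant d * real k))))"
  using assms by (intro summable_mult summable_powr_exp mult_pos_pos ball_constant_pos) auto

lemma bottleneck_series_pos:
  assumes "0 < fmin" "1 \<le> d"
  shows "0 < bottleneck_series fmin d p"
  unfolding bottleneck_series_def
  by (rule suminf_pos[OF summable_bottleneck_series[OF assms]]) simp

lemma bottleneck_constant_decreasing:
  assumes "0 < fmin" "1 \<le> d" "1 \<le> p"
  shows "strict_antimono_on {0<..} (\<lambda>\<tau>. bottleneck_constant \<tau> fmin d p)"
proof (rule monotone_onI)
  fix a b :: real assume ab: "a \<in> {0<..}" "b \<in> {0<..}" "a < b"
  then have "a\<^sup>2 < b\<^sup>2" by (intro power_strict_mono) auto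
  then have "48 / b\<^sup>2 < 48 / a\<^sup>2" using ab by (intro divide_strict_left_mono) auto
  then have "(48 / b\<^sup>2) powr p < (48 / a\<^sup>2) powr p" using ab assms by (intro powr_less_mono2) auto
  then show "bottleneck_constant b fmin d p < bottleneck_constant a fmin d p"
    unfolding bottleneck_constant_def using bottleneck_series_pos[OF assms(1,2), of p] by simp
qed

section \<open>The risk bound\<close>

lemma emeasure_tangent_law_le:
  assumes "M = measure_support Q" "M \<in> sets Q" "A \<in> sets Q" "A \<subseteq> M"
    and "\<And>x. x \<in> M \<Longrightarrow> (x, tangent_space M x) \<in> Z \<Longrightarrow> x \<in> A"
  shows "emeasure (tangent_law D d Q) Z \<le> emeasure Q A"
proof -
  let ?R = "restrict_space Q M"
  have MQ: "M \<inter> space Q \<in> sets Q" using assms(2) sets.sets_into_space[OF assms(2)] by (simp add: Int_absorb2)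
  have AR: "A \<in> sets ?R" using assms(3,4) by (auto simp: sets_restrict_space_iff[OF MQ])
  have "emeasure (tangent_law D d Q) Z \<le> emeasure ?R ((\<lambda>x. (x, tangent_space M x)) -` Z \<inter> space ?R)"
    unfolding tangent_law_def assms(1)[symmetric] by (rule emeasure_distr_le)
  also have "\<dots> \<le> emeasure ?R A"
    using assms(5) AR by (intro emeasure_mono) (auto simp: space_restrict_space)
  also have "\<dots> = emeasure Q A" by (rule emeasure_restrict_space[OF MQ assms(4)])
  finally show ?thesis .
qed

lemma product_power_mass:
  fixes P :: "'a measure"
  assumes "finite_measure P" "Z \<in> sets P"
  shows "emeasure (\<Pi>\<^sub>M i\<in>{1..n::nat}. P) (\<Pi>\<^sub>E i\<in>{1..n}. Z) = emeasure P Z ^ n"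
proof -
  interpret finite_measure P by fact
  interpret product_sigma_finite "\<lambda>_::nat. P" ..
  show ?thesis using assms(2) by (subst emeasure_PiM) auto
qed

lemma AE_product_coordinates:
  fixes P :: "'a measure"
  assumes "finite_measure P" "Z \<in> sets P" "emeasure P Z = 0"
  shows "AE \<omega> in (\<Pi>\<^sub>M i\<in>{1..n::nat}. P). \<forall>i\<in>{1..n}. \<omega> i \<notin> Z"
proof (rule AE_finite_allI)
  interpret finite_measure P by fact
  interpret product_sigma_finite "\<lambda>_::nat. P" ..
  fix i assume i: "i \<in> {1..n}"
  let ?E = "\<Pi>\<^sub>E j\<in>{1..n}. if j = i then Z else space P"
  show "AE \<omega> in (\<Pi>\<^sub>M i\<in>{1..n}. P). \<omega> i \<notin> Z"
  proof (rule AE_I)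
    show "{\<omega> \<in> space (\<Pi>\<^sub>M i\<in>{1..n}. P). \<not> \<omega> i \<notin> Z} \<subseteq> ?E"
      by (auto simp: space_PiM PiE_def extensional_def)
    show "emeasure (\<Pi>\<^sub>M i\<in>{1..n}. P) ?E = 0"
      using assms i by (subst emeasure_PiM) (auto intro!: prod_zero bexI[of _ i])
    show "?E \<in> sets (\<Pi>\<^sub>M i\<in>{1..n}. P)"
      using assms by (intro sets_PiM_I_finite) auto
  qed
qed simp

context framed_reach
begin

text \<open>
The loss is split according to the number \<open>k\<close> for which the sample first meets both balls of radius
\<open>(k + 1) h\<close> around \<open>q1\<close> and \<open>q2\<close>, with \<open>h = n\<^sup>-\<^sup>1\<^sup>/\<^sup>d\<close>. As long as
\<open>k h\<close> is small compared to \<open>\<tau>\<close>, a ball of radius \<open>k h\<close> has mass at least \<open>c k\<^sup>d / n\<close> and is therefore missed by all sample points with probability at most \<open>exp (- c k\<^sup>d)\<close>.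
\<close>

theorem bottleneck_risk:
  fixes P :: "(fseq \<times> fseq set) measure"
  assumes Q: "prob_space Q" "sets Q = sets (restrict_space borel (Rn D))"
    and supp: "measure_support Q = M"
    and dens: "Q = density (restrict_space (hausdorff_measure d) (Rn D)) (\<lambda>x. ennreal (f x) * indicator M x)"
    and f: "f \<in> borel_measurable (restrict_space borel M)" "\<forall>x\<in>M. fmin \<le> f x" and fmin: "0 < fmin"
    and P: "P = tangent_law D d Q"
    and q1: "q1 \<in> M" and nu: "\<nu> \<in> Rn D" "norm \<nu> = 1"
    and q2: "q2 \<in> M" "q2 = q1 + (2 * \<tau>) *\<^sub>R \<nu>"
    and far: "\<And>y. y \<in> M \<Longrightarrow> \<tau> \<le> norm (y - (q1 + \<tau> *\<^sub>R \<nu>))"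
    and p: "1 \<le> p" and n: "1 \<le> n"
  shows "(\<integral>\<^sup>+ \<omega>. abs_powr (1 / ereal \<tau> - 1 / tau_hat M ((\<lambda>i. fst (\<omega> i)) ` {1..n})) p
             \<partial>(\<Pi>\<^sub>M i\<in>{1..n}. P))
         \<le> ennreal (bottleneck_constant \<tau> fmin d p * real n powr (- p / real d))"
proof -
  interpret Q: prob_space Q by (rule Q)
  have spQ: "space Q = Rn D" using sets_eq_imp_space_eq[OF Q(2)] by (simp add: space_restrict_space)
  have setsQ: "A \<in> sets Q" if "A \<in> sets borel" "A \<subseteq> Rn D" for A
    unfolding Q(2) sets_restrict_space using that by (auto intro!: image_eqI[of _ _ A])
  have MQ: "M \<in> sets Q" using M_borel M_Rn by (rule setsQ)
  note law = emeasure_tangent_law_le[OF supp[symmetric] MQ, of _ _ D d, folded P]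
  have spP: "space P = Rn D \<times> space (grassmannian_borel D d)"
    unfolding P tangent_law_def by (simp add: space_pair_measure space_restrict_space)
  have measP: "{z \<in> space P. fst z \<in> A} \<in> sets P" if "A \<in> sets borel" for A
  proof -
    have "fst \<in> P \<rightarrow>\<^sub>M restrict_space borel (Rn D)"
      unfolding P tangent_law_def measurable_distr_eq1 by (rule measurable_fst)
    then have "fst \<in> P \<rightarrow>\<^sub>M borel" by (rule measurable_restrict_space2_iff[THEN iffD1, THEN conjunct1, rotated -1])
    from measurable_sets[OF this that] show ?thesis by (simp add: vimage_def Int_def conj_commute)
  qed
  have Pmass: "emeasure P Z \<le> 1" for Z
    using law[of M Z] MQ Q.emeasure_le_1[of M] by (meson order_trans order_refl)
  have finP: "finite_measure P"
    by (rule finite_measureI) (use Pmass[of "space P"] in \<open>auto simp: top_unique\<close>)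
  define c where "c = fmin * ball_constant d"
  have c: "0 < c" unfolding c_def using fmin d_pos by (simp add: ball_constant_pos)
  define Z where "Z q r = {z \<in> space P. fst z \<notin> ball q r}" for q r
  have Zsets: "Z q r \<in> sets P" for q r
    using measP[of "- ball q r"] by (simp add: Z_def)
  have miss: "emeasure P (Z q r) \<le> ennreal (exp (- (c * r ^ d)))"
    if q: "q \<in> M" and r: "0 \<le> r" "r \<le> \<tau> / 2" for q r
  proof (cases "r = 0")
    case True
    then show ?thesis using Pmass d_pos by (simp add: zero_power)
  next
    case False
    have "ennreal (fmin * (ball_constant d * r ^ d)) \<le> emeasure Q (M \<inter> ball q r)"
      by (rule density_ball_ge[OF Q(1) dens f fmin q]) (use r False in auto)
    then have "c * r ^ d \<le> measure Q (M \<inter> ball q r)"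
      by (simp add: Q.emeasure_eq_measure c_def mult.assoc)
    moreover have B: "M \<inter> ball q r \<in> sets Q"
      using M_borel M_Rn by (intro setsQ) auto
    then have "measure Q (M - M \<inter> ball q r) = measure Q M - measure Q (M \<inter> ball q r)"
      using MQ by (intro Q.finite_measure_Diff) auto
    ultimately have "measure Q (M - M \<inter> ball q r) \<le> 1 - c * r ^ d"
      using Q.prob_le_1[of M] by linarith
    also have "\<dots> \<le> exp (- (c * r ^ d))" using exp_ge_add_one_self[of "- (c * r ^ d)"] by simp
    finally have "emeasure Q (M - M \<inter> ball q r) \<le> ennreal (exp (- (c * r ^ d)))"
      by (simp add: Q.emeasure_eq_measure)
    moreover have "emeasure P (Z q r) \<le> emeasure Q (M - M \<inter> ball q r)"
      by (rule law) (use MQ B in \<open>auto simp: Z_def\<close>)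
    ultimately show ?thesis by (rule order_trans[rotated])
  qed
  have "emeasure P {z \<in> space P. fst z \<in> - M} \<le> emeasure Q {}"
    by (rule law) auto
  then have "AE \<omega> in (\<Pi>\<^sub>M i\<in>{1..n}. P). \<forall>i\<in>{1..n}. \<omega> i \<notin> {z \<in> space P. fst z \<in> - M}"
    using M_borel by (intro AE_product_coordinates finP measP) auto
  then have AEM: "AE \<omega> in (\<Pi>\<^sub>M i\<in>{1..n}. P). (\<lambda>i. fst (\<omega> i)) ` {1..n} \<subseteq> M"
    using AE_space by eventually_elim (auto simp: space_PiM PiE_iff)
  define h where "h = real n powr (- 1 / real d)"
  have h: "0 < h" "h ^ d = 1 / real n"
  proof -
    show "0 < h" using n by (simp add: h_def)
    have "h ^ d = h powr real d" using \<open>0 < h\<close> by (simp add: powr_realpow)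
    also have "\<dots> = 1 / real n" 
    proof -
      have "h powr real d = real n powr (- 1)" unfolding h_def powr_powr using d_pos by simp
      then show ?thesis by (simp add: powr_minus_divide)
    qed
    finally show "h ^ d = 1 / real n" .
  qed
  \<comment> \<open>\<open>h\<close> is the radius at which a ball has mass of order \<open>1 / n\<close>. Radii beyond \<open>\<tau> / 48\<close> are
    disregarded: there the trivial bound \<open>1 / \<tau>\<close> on the loss is the better one, and this is within the
    range in which the mass of balls is controlled.\<close>
  define W where "W q k = (if real k * h < \<tau> / 48 then Z q (real k * h) else {})" for q and k :: nat
  define E where "E q k = (\<Pi>\<^sub>E i\<in>{1..n}. W q k)" for q k
  have Wsets: "W q k \<in> sets P" for q k by (simp add: W_def Zsets)
  have Esets: "E q k \<in> sets (\<Pi>\<^sub>M i\<in>{1..n}. P)" for q k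
    unfolding E_def using Wsets by (intro sets_PiM_I_finite) auto
  have Emass: "emeasure (\<Pi>\<^sub>M i\<in>{1..n}. P) (E q k) \<le> ennreal (exp (- (c * real k)))" if q: "q \<in> M" for q k
  proof -
    have "emeasure P (W q k) \<le> ennreal (exp (- (c * (real k * h) ^ d)))"
      using miss[OF q, of "real k * h"] h tau_pos by (auto simp: W_def)
    then have "emeasure P (W q k) ^ n \<le> ennreal (exp (- (c * (real k * h) ^ d))) ^ n"
      by (rule power_mono) simp
    also have "\<dots> = ennreal (exp (- (c * real k ^ d)))"
      using n h by (simp add: ennreal_power exp_of_nat_mult[symmetric] power_mult_distrib)
    also have "\<dots> \<le> ennreal (exp (- (c * real k)))"
    proof -
      have "real k \<le> real k ^ d" using d_pos by (cases k) (auto intro: self_le_power)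
      then show ?thesis using c by (intro ennreal_leI) simp
    qed
    finally show ?thesis unfolding E_def product_power_mass[OF finP Wsets] .
  qed
  define a where "a k = ((48 / \<tau>\<^sup>2 * h) * (real k + 1)) powr p" for k :: nat
  have bound: "abs_powr (1 / ereal \<tau> - 1 / tau_hat M ((\<lambda>i. fst (\<omega> i)) ` {1..n})) p
      \<le> (suminf (\<lambda>k. ennreal (a k) * (indicator (E q1 k) \<omega> + indicator (E q2 k) \<omega>)))"
    if \<omega>: "\<omega> \<in> space (\<Pi>\<^sub>M i\<in>{1..n}. P)" and X: "(\<lambda>i. fst (\<omega> i)) ` {1..n} \<subseteq> M" for \<omega>
  proof -
    let ?X = "(\<lambda>i. fst (\<omega> i)) ` {1..n}"
    let ?l = "abs_powr (1 / ereal \<tau> - 1 / tau_hat M ?X) p"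
    define hit where "hit k \<longleftrightarrow> \<tau> / 48 \<le> real k * h \<or>
      ((\<exists>x\<in>?X. x \<in> ball q1 (real k * h)) \<and> (\<exists>x\<in>?X. x \<in> ball q2 (real k * h)))" for k
    obtain N :: nat where "\<tau> / 48 / h < real N" using reals_Archimedean2 by blast
    then have "hit (Suc N)" using h by (auto simp: hit_def field_simps intro: order_trans)
    \<comment> \<open>With the least such \<open>k\<close>, the sample misses a ball of radius \<open>k h\<close>, while the loss is at most
      the one belonging to radius \<open>(k + 1) h\<close>.\<close>
    then obtain k where k: "hit (Suc k)" "\<And>j. j < k \<Longrightarrow> \<not> hit (Suc j)"
      using exists_least_iff[of "\<lambda>k. hit (Suc k)"] by blast
    have mem: "\<omega> \<in> E q 0" for q
      using \<omega> tau_pos by (auto simp: E_def W_def Z_def space_PiM PiE_iff)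
    have E: "\<omega> \<in> E q1 k \<or> \<omega> \<in> E q2 k"
    proof (cases k)
      case (Suc j)
      then have "\<not> hit k" using k(2)[of j] by simp
      then show ?thesis using \<omega> by (auto simp: hit_def E_def W_def Z_def space_PiM PiE_iff)
    qed (use mem in simp)
    define r where "r = real (Suc k) * h"
    have r: "0 < r" using h by (simp add: r_def)
    have "?l \<le> ennreal ((48 * r / \<tau>\<^sup>2) powr p)"
    proof (cases "\<tau> / 48 \<le> r")
      case True
      then have "1 / \<tau> \<le> 48 * r / \<tau>\<^sup>2" using tau_pos by (simp add: field_simps power2_eq_square)
      then have le: "ennreal ((1 / \<tau>) powr p) \<le> ennreal ((48 * r / \<tau>\<^sup>2) powr p)"
        using tau_pos p by (intro ennreal_leI powr_mono2) auto
      have "?l \<le> ennreal ((1 / \<tau>) powr p)" using p by (intro loss_le_trivial[OF X]) simp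
      then show ?thesis using le by (rule order_trans)
    next
      case False
      then obtain x y where x: "x \<in> ?X" "x \<in> ball q1 r" and y: "y \<in> ?X" "y \<in> ball q2 r"
        using k(1) unfolding hit_def r_def by auto
      have "norm (x - q1) \<le> r" "norm (y - q2) \<le> r"
        using x(2) y(2) by (simp_all add: dist_norm norm_minus_commute)
      then show ?thesis
        using p by (intro loss_le_near_bottleneck[OF X _ q1 nu q2(2) far x(1) _ y(1) _ r]) simp_all
    qed
    also have "(48 * r / \<tau>\<^sup>2) = (48 / \<tau>\<^sup>2 * h) * (real k + 1)" by (simp add: r_def algebra_simps)
    also have "ennreal (((48 / \<tau>\<^sup>2 * h) * (real k + 1)) powr p) \<le> ennreal (a k) * (indicator (E q1 k) \<omega> + indicator (E q2 k) \<omega>)"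
      using E by (auto simp: a_def indicator_def distrib_left)
    also have "\<dots> = (\<Sum>j\<in>{k}. ennreal (a j) * (indicator (E q1 j) \<omega> + indicator (E q2 j) \<omega>))" by simp
    also have "\<dots> \<le> (suminf (\<lambda>k. ennreal (a k) * (indicator (E q1 k) \<omega> + indicator (E q2 k) \<omega>)))"
      by (rule sum_le_suminf) auto
    finally show ?thesis .
  qed
  have "(\<integral>\<^sup>+ \<omega>. abs_powr (1 / ereal \<tau> - 1 / tau_hat M ((\<lambda>i. fst (\<omega> i)) ` {1..n})) p \<partial>(\<Pi>\<^sub>M i\<in>{1..n}. P))
      \<le> (\<integral>\<^sup>+ \<omega>. suminf (\<lambda>k. ennreal (a k) * (indicator (E q1 k) \<omega> + indicator (E q2 k) \<omega>)) \<partial>(\<Pi>\<^sub>M i\<in>{1..n}. P))"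
    by (rule nn_integral_mono_AE) (use AEM AE_space in eventually_elim, rule bound)
  also have "\<dots> = suminf (\<lambda>k. \<integral>\<^sup>+ \<omega>. ennreal (a k) * (indicator (E q1 k) \<omega> + indicator (E q2 k) \<omega>) \<partial>(\<Pi>\<^sub>M i\<in>{1..n}. P))"
    by (intro nn_integral_suminf borel_measurable_times_ennreal borel_measurable_add
        borel_measurable_indicator measurable_const Esets) auto
  also have "\<dots> \<le> suminf (\<lambda>k. ennreal (a k * (2 * exp (- (c * real k)))))"
  proof (intro suminf_le)
    fix k
    have "(\<integral>\<^sup>+ \<omega>. ennreal (a k) * (indicator (E q1 k) \<omega> + indicator (E q2 k) \<omega>) \<partial>(\<Pi>\<^sub>M i\<in>{1..n}. P))
        = ennreal (a k) * (emeasure (\<Pi>\<^sub>M i\<in>{1..n}. P) (E q1 k) + emeasure (\<Pi>\<^sub>M i\<in>{1..n}. P) (E q2 k))"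
      using Esets by (subst nn_integral_cmult) (auto simp: nn_integral_add)
    also have "\<dots> \<le> ennreal (a k) * (ennreal (exp (- (c * real k))) + ennreal (exp (- (c * real k))))"
      by (intro mult_left_mono add_mono Emass q1 q2(1)) simp
    also have "\<dots> = ennreal (a k * (2 * exp (- (c * real k))))"
      by (simp add: ennreal_plus[symmetric] ennreal_mult[symmetric] a_def)
    finally show "(\<integral>\<^sup>+ \<omega>. ennreal (a k) * (indicator (E q1 k) \<omega> + indicator (E q2 k) \<omega>) \<partial>(\<Pi>\<^sub>M i\<in>{1..n}. P))
        \<le> ennreal (a k * (2 * exp (- (c * real k))))" .
  qed auto
  also have "(\<lambda>k. a k * (2 * exp (- (c * real k)))) =
      (\<lambda>k. (48 / \<tau>\<^sup>2 * h) powr p * (2 * ((real k + 1) powr p * exp (- (c * real k)))))"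
  proof
    fix k
    have "a k = (48 / \<tau>\<^sup>2 * h) powr p * (real k + 1) powr p"
      unfolding a_def by (rule powr_mult)
    then show "a k * (2 * exp (- (c * real k))) =
        (48 / \<tau>\<^sup>2 * h) powr p * (2 * ((real k + 1) powr p * exp (- (c * real k))))" by simp
  qed
  also have "suminf (\<lambda>k. ennreal ((48 / \<tau>\<^sup>2 * h) powr p * (2 * ((real k + 1) powr p * exp (- (c * real k))))))
      = ennreal ((48 / \<tau>\<^sup>2 * h) powr p * bottleneck_series fmin d p)"
  proof -
    have s: "summable (\<lambda>k. 2 * ((real k + 1) powr p * exp (- (c * real k))))"
      unfolding c_def using fmin d_pos by (intro summable_bottleneck_series) auto
    show ?thesis
      unfolding bottleneck_series_def c_def[symmetric] suminf_mult[OF s, symmetric]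
      using s by (intro suminf_ennreal2 summable_mult) auto
  qed
  also have "(48 / \<tau>\<^sup>2 * h) powr p * bottleneck_series fmin d p
      = bottleneck_constant \<tau> fmin d p * real n powr (- p / real d)"
  proof -
    have "h powr p = real n powr (- p / real d)" by (simp add: h_def powr_powr)
    then show ?thesis
      unfolding bottleneck_constant_def powr_mult by (simp only: mult.assoc mult.commute mult.left_commute)
  qed
  finally show ?thesis .
qed

end

text \<open>Equality in the triangle inequality: the centre in the medial axis is the midpoint of the bottleneck.\<close>

lemma midpoint_of_extremal:
  fixes u v :: "'a::real_inner"
  assumes "norm u \<le> t" "norm v \<le> t" "norm (u - v) = 2 * t"
  shows "v = - u"
proof -
  have "(norm (u + v))\<^sup>2 + (norm (u - v))\<^sup>2 = 2 * (norm u)\<^sup>2 + 2 * (norm v)\<^sup>2"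
    unfolding power2_norm_eq_inner
    by (simp add: inner_add_left inner_add_right inner_diff_left inner_diff_right)
  moreover have "(norm u)\<^sup>2 \<le> t\<^sup>2" "(norm v)\<^sup>2 \<le> t\<^sup>2" using assms by (auto intro: power_mono)
  moreover have "(norm (u - v))\<^sup>2 = 4 * t\<^sup>2" using assms(3) by (simp add: power_mult_distrib)
  ultimately have "(norm (u + v))\<^sup>2 \<le> 0" by linarith
  then have "u + v = 0" by simp
  then show ?thesis by (simp add: eq_neg_iff_add_eq_0 add.commute)
qed

theorem proposition4p3:
  shows "\<exists>C :: real \<Rightarrow> real \<Rightarrow> nat \<Rightarrow> real \<Rightarrow> real.
    (\<forall>fmin d p. 0 < fmin \<and> 1 \<le> d \<and> 1 \<le> p \<longrightarrow> strict_antimono_on {0<..} (\<lambda>\<tau>. C \<tau> fmin d p)) \<and>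
    (\<forall>(D::nat) (d::nat) (\<tau>min::real) (L::real) (fmin::real) (p::real) Q P M q1 q2 (n::nat).
       2 \<le> D \<and> 1 \<le> d \<and> d < D \<and> 0 < \<tau>min \<and> 0 < L \<and> 0 < fmin \<and> 1 \<le> p \<and> 1 \<le> n \<and>
       Q \<in> Q_class D d \<tau>min L fmin \<and> P \<in> P_class D d \<tau>min L fmin \<and> P = tangent_law D d Q \<and>
       M = measure_support Q \<and> bottleneck D M q1 q2 \<longrightarrow>
       enn2ereal (\<integral>\<^sup>+ \<omega>. abs_powr (1 / reach D M - 1 / tau_hat M ((\<lambda>i. fst (\<omega> i)) ` {1..n})) p
                    \<partial>(\<Pi>\<^sub>M i\<in>{1..n}. P))
         \<le> ereal (C (real_of_ereal (reach D M)) fmin d p * real n powr (- p / real d)))"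
proof (rule exI[of _ bottleneck_constant], intro conjI allI impI; (elim conjE)?)
  show "strict_antimono_on {0<..} (\<lambda>\<tau>. bottleneck_constant \<tau> fmin d p)"
    if "0 < fmin" "1 \<le> d" "1 \<le> p" for fmin d p
    using that by (rule bottleneck_constant_decreasing)
next
  fix D d :: nat and \<tau>min L fmin p :: real and Q P M q1 q2 and n :: nat
  assume D: "2 \<le> D" and d: "1 \<le> d" and tmin: "0 < \<tau>min" and fmin: "0 < fmin" and p: "1 \<le> p" and n: "1 \<le> n"
    and Q: "Q \<in> Q_class D d \<tau>min L fmin" and P: "P = tangent_law D d Q" and M: "M = measure_support Q"
    and bn: "bottleneck D M q1 q2"
  obtain f where Qp: "prob_space Q" "sets Q = sets (restrict_space borel (Rn D))"
    and mfd: "M \<in> manifold_class D d \<tau>min L"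
    and f: "f \<in> borel_measurable (restrict_space borel M)" "\<forall>x\<in>M. fmin \<le> f x"
    and dens: "Q = density (restrict_space (hausdorff_measure d) (Rn D)) (\<lambda>x. ennreal (f x) * indicator M x)"
    using Q unfolding Q_class_def M by auto
  obtain z where q: "q1 \<in> M" "q2 \<in> M" and z: "z \<in> medial_axis D M"
    "ereal (norm (q1 - z)) \<le> reach D M" "ereal (norm (q2 - z)) \<le> reach D M"
    and q12: "ereal (norm (q1 - q2)) = 2 * reach D M"
    using bn by (auto simp: bottleneck_def)
  define \<tau> where "\<tau> = real_of_ereal (reach D M)"
  have "ereal \<tau>min \<le> reach D M" using mfd by (simp add: manifold_class_def)
  then have tau: "reach D M = ereal \<tau>" "0 < \<tau>"
    using q12 tmin unfolding \<tau>_def by (cases "reach D M"; auto)+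
  have medial: "\<tau> \<le> infdist y M" if "y \<in> medial_axis D M" for y
    using INF_lower[OF that, of "\<lambda>z. ereal (infdist z M)"] tau by (simp add: reach_def)
  interpret framed_reach D M \<tau> d
  proof
    show "compact M" "M \<subseteq> Rn D" using mfd by (auto simp: manifold_class_def C2_submanifold_def)
    show "\<exists>b. tangent_frame D d M x b" if "x \<in> M" for x
      using mfd that by (intro C2_tangent_frame) (simp add: manifold_class_def)
  qed (use D d q tau medial in auto)
  define \<nu> where "\<nu> = (z - q1) /\<^sub>R \<tau>"
  have near: "norm (q1 - z) \<le> \<tau>" "norm (q2 - z) \<le> \<tau>" using z tau by auto
  have zd: "\<tau> \<le> infdist z M" using medial z by blast
  have far: "\<tau> \<le> norm (y - z)" if "y \<in> M" for y
    using infdist_le[OF that, of z] zd by (simp add: dist_norm norm_minus_commute)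
  have "norm (q1 - z) = \<tau>" using near(1) far[OF q(1)] by simp
  then have nu1: "norm \<nu> = 1" using tau by (simp add: \<nu>_def norm_minus_commute)
  have "norm ((q1 - z) - (q2 - z)) = 2 * \<tau>" using q12 tau by simp
  then have "q2 - z = - (q1 - z)" by (rule midpoint_of_extremal[OF near])
  then have "q2 = z + (z - q1)" by (simp add: algebra_simps)
  moreover have zq: "z = q1 + \<tau> *\<^sub>R \<nu>" using tau by (simp add: \<nu>_def)
  ultimately have q2eq: "q2 = q1 + (2 * \<tau>) *\<^sub>R \<nu>" by (simp add: scaleR_2 scaleR_scaleR[symmetric] del: scaleR_scaleR)
  have nuRn: "\<nu> \<in> Rn D"
    unfolding \<nu>_def using z(1) q M_Rn
    by (auto simp: medial_axis_def intro!: subspace_scale[OF subspace_Rn] subspace_diff[OF subspace_Rn])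
  have "(\<integral>\<^sup>+ \<omega>. abs_powr (1 / ereal \<tau> - 1 / tau_hat M ((\<lambda>i. fst (\<omega> i)) ` {1..n})) p \<partial>(\<Pi>\<^sub>M i\<in>{1..n}. P))
      \<le> ennreal (bottleneck_constant \<tau> fmin d p * real n powr (- p / real d))"
    by (rule bottleneck_risk[OF Qp M[symmetric] dens f fmin P q(1) nuRn nu1 q(2) q2eq _ p n])
      (use far zq in simp)
  moreover have "0 \<le> bottleneck_constant \<tau> fmin d p * real n powr (- p / real d)"
    unfolding bottleneck_constant_def using bottleneck_series_pos[OF fmin d, of p] by simp
  ultimately show "enn2ereal (\<integral>\<^sup>+ \<omega>. abs_powr (1 / reach D M - 1 / tau_hat M ((\<lambda>i. fst (\<omega> i)) ` {1..n})) p
                    \<partial>(\<Pi>\<^sub>M i\<in>{1..n}. P))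
         \<le> ereal (bottleneck_constant (real_of_ereal (reach D M)) fmin d p * real n powr (- p / real d))"
    unfolding \<tau>_def[symmetric] unfolding tau(1)
    by (simp add: less_eq_ennreal.rep_eq enn2ereal_ennreal)
qed

end
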